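(* Let $N\ge2$, $0<g_1<\cdots<g_N$, $f_{ij}=g_i+g_j$ for $i\ne j$, and let $\Omega\subset\mathbb R^d$ ($d\ge2$) be a bounded domain of class $C^2$. Let $y$, with values in the open simplex, be a classical solution of $$\partial_ty_i+\operatorname{div}J_i=0,\qquad \partial_{x_k}y=B(y)J^k\ (k=1,\dots,d),\qquad \sum_{i=1}^NJ_i=0\quad\text{in }\Omega,\qquad J_i\cdot\nu=0\ \text{ on }\partial\Omega\quad(i=1,\dots,N).$$ Then the root variables $z_j=z_j(y(t,x))$ satisfy, for $j=1,\dots,N-1$, $$\partial_tz_j-\operatorname{div}\Bigl(\frac{\nabla z_j}{\lambda_j}\Bigr)+\sum_{k\ne j}\frac{\lambda_j+\lambda_k}{\lambda_j\lambda_k(\lambda_j-\lambda_k)}\,\nabla z_j\cdot\nabla z_k=0,$$ where $\lambda_j=z_j+\sum_{i=1}^Ng_iy_i$, together with the homogeneous Neumann boundary condition $\partial_\nu z_j=0$ on $\partial\Omega$.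
   Context: $J=(J_1,\dots,J_N)^{\sf T}$ with $J_i\in\mathbb R^d$, and $J^k\in\mathbb R^N$ denotes its $k$-th column. The Maxwell--Stefan matrix is $B_{ij}(y)=y_if_{ij}$ for $i\ne j$, $B_{ii}(y)=-\sum_{\ell\ne i}f_{i\ell}y_\ell$. The open simplex is $\{y\in(0,1)^N:\sum_iy_i=1\}$. For $y$ in the open simplex, $z_j(y)$ is the unique zero of $\zeta\mapsto\sum_iy_i/(g_i-\zeta)$ in $(g_j,g_{j+1})$, $j=1,\dots,N-1$. A classical solution is one whose derivatives $\partial_ty$, $\nabla y$, $D_x^2y$ exist and are continuous (with $\nabla y$ continuous up to $\partial\Omega$), so that all equations hold pointwise. The sums over $k$ run over $k\in\{1,\dots,N-1\}\setminus\{j\}$. *)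

theory Defs
  imports "HOL-Analysis.Analysis"
begin

text \<open>
  Spatial derivatives are taken within a set \<open>S\<close>. At interior points of \<open>S\<close> they are the ordinary
  ones; at a boundary point of \<open>S = closure \<Omega>\<close>, with \<open>\<Omega>\<close> a \<open>C\<^sup>2\<close> domain, they are the (uniquely
  determined) one-sided derivatives of a function given on the closed domain.
\<close>

definition partial_deriv ::
    "(real^'d) set \<Rightarrow> 'd \<Rightarrow> (real^'d \<Rightarrow> real) \<Rightarrow> real^'d \<Rightarrow> real" where
  "partial_deriv S k f x = frechet_derivative f (at x within S) (axis k 1)"

definition grad :: "(real^'d) set \<Rightarrow> (real^'d \<Rightarrow> real) \<Rightarrow> real^'d \<Rightarrow> real^'d" where
  "grad S f x = (\<chi> k. partial_deriv S k f x)"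

definition divergence :: "(real^'d) set \<Rightarrow> (real^'d \<Rightarrow> real^'d) \<Rightarrow> real^'d \<Rightarrow> real" where
  "divergence S F x = (\<Sum>k\<in>UNIV. partial_deriv S k (\<lambda>x'. F x' $ k) x)"


definition C2_function :: "(real^'d \<Rightarrow> real) \<Rightarrow> bool" where
  "C2_function f \<longleftrightarrow>
     f differentiable_on UNIV \<and>
     (\<forall>k. partial_deriv UNIV k f differentiable_on UNIV) \<and>
     (\<forall>k l. continuous_on UNIV (partial_deriv UNIV l (partial_deriv UNIV k f)))"

text \<open>
  In coordinates with vertical direction the unit vector \<open>e\<close>, \<open>x - (x \<bullet> e) *\<^sub>R e\<close> is the horizontal
  part of \<open>x\<close>. The function below is negative exactly strictly above the graph of \<open>\<gamma>\<close>; only the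
  restriction of \<open>\<gamma>\<close> to the hyperplane orthogonal to \<open>e\<close> matters.
\<close>

definition below_graph :: "real^'d \<Rightarrow> (real^'d \<Rightarrow> real) \<Rightarrow> real^'d \<Rightarrow> real" where
  "below_graph e \<gamma> x = \<gamma> (x - (x \<bullet> e) *\<^sub>R e) - x \<bullet> e"

definition C2_graph_at ::
    "(real^'d) set \<Rightarrow> real^'d \<Rightarrow> real \<Rightarrow> real^'d \<Rightarrow> (real^'d \<Rightarrow> real) \<Rightarrow> bool" where
  "C2_graph_at \<Omega> p r e \<gamma> \<longleftrightarrow>
     r > 0 \<and> norm e = 1 \<and> C2_function \<gamma> \<and>
     \<Omega> \<inter> ball p r = {x \<in> ball p r. below_graph e \<gamma> x < 0}"

definition bounded_C2_domain :: "(real^'d) set \<Rightarrow> bool" where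
  "bounded_C2_domain \<Omega> \<longleftrightarrow>
     open \<Omega> \<and> connected \<Omega> \<and> \<Omega> \<noteq> {} \<and> bounded \<Omega> \<and>
     (\<forall>p\<in>frontier \<Omega>. \<exists>r e \<gamma>. C2_graph_at \<Omega> p r e \<gamma>)"

text \<open>
  \<open>below_graph e \<gamma>\<close> is a local defining function of the domain, negative inside, so its normalised
  gradient at \<open>p\<close> is the outer unit normal. It does not depend on the choice of \<open>r\<close>, \<open>e\<close>, \<open>\<gamma>\<close>.
\<close>

definition outer_unit_normal :: "(real^'d) set \<Rightarrow> real^'d \<Rightarrow> real^'d \<Rightarrow> bool" where
  "outer_unit_normal \<Omega> p n \<longleftrightarrow>
     (\<exists>r e \<gamma>. C2_graph_at \<Omega> p r e \<gamma> \<and> n = sgn (grad UNIV (below_graph e \<gamma>) p))"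


text \<open>Vectors in \<open>\<real>\<^sup>N\<close> are functions on \<open>nat\<close>, of which only the entries \<open>1, \<dots>, N\<close> are used.\<close>

definition open_simplex :: "nat \<Rightarrow> (nat \<Rightarrow> real) set" where
  "open_simplex N = {y. (\<forall>i\<in>{1..N}. 0 < y i \<and> y i < 1) \<and> (\<Sum>i=1..N. y i) = 1}"

definition MS_matrix ::
    "nat \<Rightarrow> (nat \<Rightarrow> nat \<Rightarrow> real) \<Rightarrow> (nat \<Rightarrow> real) \<Rightarrow> nat \<Rightarrow> nat \<Rightarrow> real" where
  "MS_matrix N f y i j =
     (if i = j then - (\<Sum>l\<in>{1..N} - {i}. f i l * y l) else y i * f i j)"

definition root_var :: "nat \<Rightarrow> (nat \<Rightarrow> real) \<Rightarrow> nat \<Rightarrow> (nat \<Rightarrow> real) \<Rightarrow> real" where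
  "root_var N g j y =
     (THE \<zeta>. \<zeta> \<in> {g j<..<g (Suc j)} \<and> (\<Sum>i=1..N. y i / (g i - \<zeta>)) = 0)"


definition classical_regularity ::
    "real set \<Rightarrow> (real^'d) set \<Rightarrow> (real \<Rightarrow> real^'d \<Rightarrow> real) \<Rightarrow> bool" where
  "classical_regularity I \<Omega> u \<longleftrightarrow>
     (\<forall>t\<in>I. \<forall>x\<in>\<Omega>. (\<lambda>s. u s x) differentiable (at t)) \<and>
     continuous_on (I \<times> \<Omega>) (\<lambda>(t, x). deriv (\<lambda>s. u s x) t) \<and>
     (\<forall>t\<in>I. u t differentiable_on closure \<Omega>) \<and>
     continuous_on (I \<times> closure \<Omega>) (\<lambda>(t, x). grad (closure \<Omega>) (u t) x) \<and>
     (\<forall>t\<in>I. \<forall>k. partial_deriv (closure \<Omega>) k (u t) differentiable_on \<Omega>) \<and>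
     (\<forall>k l. continuous_on (I \<times> \<Omega>)
        (\<lambda>(t, x). partial_deriv (closure \<Omega>) l (partial_deriv (closure \<Omega>) k (u t)) x))"

text \<open>
  \<open>y t x i\<close> and \<open>J t x i\<close> are the \<open>i\<close>-th component and its flux, on the time interval \<open>I\<close> and the
  closed domain. The continuity requirement on \<open>J\<close> only says that its values on the boundary are
  the limits from inside. No differentiability of \<open>J\<close> is required: with \<open>f i j = g i + g j\<close>,
  \<open>g i > 0\<close>, the equations for \<open>\<nabla>y\<close> and \<open>\<Sum>J i = 0\<close> determine \<open>J\<close> as a smooth function of \<open>y\<close>, \<open>\<nabla>y\<close>,
  so that its divergence exists in \<open>\<Omega>\<close>.
\<close>

definition classical_MS_solution ::
    "nat \<Rightarrow> (nat \<Rightarrow> nat \<Rightarrow> real) \<Rightarrow> real set \<Rightarrow> (real^'d) set \<Rightarrow> (real^'d \<Rightarrow> real^'d) \<Rightarrow>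
     (real \<Rightarrow> real^'d \<Rightarrow> nat \<Rightarrow> real) \<Rightarrow> (real \<Rightarrow> real^'d \<Rightarrow> nat \<Rightarrow> real^'d) \<Rightarrow> bool" where
  "classical_MS_solution N f I \<Omega> \<nu> y J \<longleftrightarrow>
     (\<forall>i\<in>{1..N}. classical_regularity I \<Omega> (\<lambda>t x. y t x i)) \<and>
     (\<forall>i\<in>{1..N}. \<forall>t\<in>I. continuous_on (closure \<Omega>) (\<lambda>x. J t x i)) \<and>
     (\<forall>t\<in>I. \<forall>x\<in>\<Omega>.
        (\<forall>i\<in>{1..N}. deriv (\<lambda>s. y s x i) t + divergence (closure \<Omega>) (\<lambda>x'. J t x' i) x = 0) \<and>
        (\<forall>k. \<forall>i\<in>{1..N}. partial_deriv (closure \<Omega>) k (\<lambda>x'. y t x' i) x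
            = (\<Sum>j=1..N. MS_matrix N f (y t x) i j * J t x j $ k)) \<and>
        (\<Sum>i=1..N. J t x i) = 0) \<and>
     (\<forall>t\<in>I. \<forall>x\<in>frontier \<Omega>. \<forall>i\<in>{1..N}. J t x i \<bullet> \<nu> x = 0)"

end

theory Submission
  imports Defs "HOL-Computational_Algebra.Polynomial"
begin

text \<open>
  Put \<open>F(\<zeta>) = \<Sum>\<^sub>i y\<^sub>i / (g\<^sub>i - \<zeta>)\<close>, \<open>G = \<Sum>\<^sub>i g\<^sub>i y\<^sub>i\<close>, \<open>\<Gamma> = \<Sum>\<^sub>i g\<^sub>i J\<^sub>i\<close> and \<open>S\<^sub>j = F'(z\<^sub>j)\<close>. For \<open>f\<^sub>i\<^sub>j = g\<^sub>i + g\<^sub>j\<close>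
  the Maxwell--Stefan relation reads \<open>\<nabla>y\<^sub>i = y\<^sub>i \<Gamma> - (g\<^sub>i + G) J\<^sub>i\<close>, and differentiating \<open>F(z\<^sub>j) = 0\<close> gives
  \<open>\<nabla>z\<^sub>j / \<lambda>\<^sub>j = V\<^sub>j\<close> with \<open>V\<^sub>j = (\<Sum>\<^sub>i J\<^sub>i / (g\<^sub>i - z\<^sub>j)) / S\<^sub>j\<close> and
  \<open>S\<^sub>j \<partial>\<^sub>t z\<^sub>j = \<Sum>\<^sub>i div J\<^sub>i / (g\<^sub>i - z\<^sub>j)\<close>. The vectors \<open>y\<close> and
  \<open>(y\<^sub>i / (g\<^sub>i - z\<^sub>k))\<^sub>i\<close> are orthogonal for the weight \<open>1 / y\<^sub>i\<close>, whence \<open>J\<^sub>i = y\<^sub>i \<Sum>\<^sub>k V\<^sub>k / (g\<^sub>i - z\<^sub>k)\<close>; inserting this into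
  \<open>\<partial>\<^sub>t z\<^sub>j - div V\<^sub>j\<close> leaves exactly the quadratic terms. On the boundary \<open>\<nabla>z\<^sub>j\<close> is a combination of
  the fluxes \<open>J\<^sub>i\<close>, whose normal components vanish.
\<close>

subsection \<open>Uniqueness of derivatives on the closed domain\<close>

text \<open>
  On the frontier \<^const>\<open>frechet_derivative\<close> picks some derivative within the closed domain, so the
  chain rule says nothing about \<^const>\<open>grad\<close> there until the derivative is known to be unique. The
  library criterion asks for points along the coordinate axes, which may be tangential; an open cone
  of inward directions suffices.
\<close>

lemma has_derivative_within_unique_cone:
  fixes f :: "'a::real_normed_vector \<Rightarrow> 'b::real_normed_vector"
  assumes D: "(f has_derivative D) (at x within S)" and E: "(f has_derivative E) (at x within S)"
    and V: "open V" "v0 \<in> V"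
    and cone: "\<And>v. v \<in> V \<Longrightarrow> \<forall>\<^sub>F s in at_right 0. x + s *\<^sub>R v \<in> S"
  shows "D = E"
proof -
  interpret D: bounded_linear D using D by (rule has_derivative_bounded_linear)
  interpret E: bounded_linear E using E by (rule has_derivative_bounded_linear)
  have eq: "D v = E v" if v: "v \<in> V" for v
  proof -
    \<comment> \<open>Parameters of the ray that stay in \<open>S\<close>. They fill a right
      neighbourhood of 0, so 0 is a limit point of \<open>T\<close> and the one-variable derivative
      along the ray is unique.\<close>
    define T where "T = {s. 0 < s \<and> x + s *\<^sub>R v \<in> S}"
    have ray: "((\<lambda>s. f (x + s *\<^sub>R v)) has_vector_derivative F v) (at 0 within T)"
      if F: "(f has_derivative F) (at x within S)" for F
    proof -
      interpret F: bounded_linear F using F by (rule has_derivative_bounded_linear)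
      have "((\<lambda>s. x + s *\<^sub>R v) has_derivative (\<lambda>s. s *\<^sub>R v)) (at 0 within T)"
        by (auto intro!: derivative_eq_intros)
      moreover have "(f has_derivative F) (at (x + 0 *\<^sub>R v) within (\<lambda>s. x + s *\<^sub>R v) ` T)"
        using F by (auto intro: has_derivative_subset simp: T_def)
      ultimately have "(f \<circ> (\<lambda>s. x + s *\<^sub>R v) has_derivative F \<circ> (\<lambda>s. s *\<^sub>R v)) (at 0 within T)"
        by (rule diff_chain_within)
      then show ?thesis by (simp add: has_vector_derivative_def o_def F.scaleR)
    qed
    have "\<forall>\<^sub>F s in at_right 0. s \<in> T"
      using cone[OF v] eventually_at_right_less[of 0] by eventually_elim (simp add: T_def)
    then have "at_right 0 \<le> at 0 within T"
      by (auto simp: at_within_def le_inf_iff le_principal eventually_inf_principal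
          intro: eventually_mono)
    then have "at 0 within T \<noteq> bot"
      using trivial_limit_at_right_real[of 0] by (metis bot.extremum_uniqueI trivial_limit_def)
    then show ?thesis
      using vector_derivative_unique_within[OF _ ray[OF D] ray[OF E]] by blast
  qed
  obtain r where r: "0 < r" "ball v0 r \<subseteq> V" using V by (meson open_contains_ball)
  show ?thesis
  proof
    fix w :: 'a
    \<comment> \<open>This scale keeps \<open>v0 + c *\<^sub>R w\<close> in the ball about
      \<open>v0\<close>, so any \<open>w\<close> is a multiple of a difference of two vectors of
      \<open>V\<close>; the 1 in the denominator covers \<open>w = 0\<close>.\<close>
    define c where "c = r / (2 * (norm w + 1))"
    have c: "c > 0" using r by (simp add: c_def add_nonneg_pos)
    have "c * norm w \<le> c * (norm w + 1)" using c by (intro mult_left_mono) auto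
    also have "\<dots> = r / 2" unfolding c_def using norm_ge_zero[of w] by (simp add: field_simps del: norm_ge_zero)
    finally have "c * norm w < r" using r by simp
    then have "v0 + c *\<^sub>R w \<in> V" using r c by (auto simp: dist_norm intro!: subsetD[OF r(2)])
    then have "D (v0 + c *\<^sub>R w) = E (v0 + c *\<^sub>R w)" "D v0 = E v0" using eq V by auto
    then show "D w = E w" using c by (simp add: D.add E.add D.scaleR E.scaleR)
  qed
qed

text \<open>The local defining function \<open>b\<close> is differentiable, with derivative -1 in
  the graph direction \<open>e\<close>. Hence it decreases to first order along an open half-space
  of directions, and points just ahead of \<open>p\<close> in such a direction satisfy
  \<open>b < 0\<close>, so they lie in \<Omega>.\<close>

lemma bounded_C2_domain_cone:
  assumes dom: "bounded_C2_domain \<Omega>" and p: "p \<in> frontier \<Omega>"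
  obtains V v0 where "open V" "v0 \<in> V"
    and "\<And>v. v \<in> V \<Longrightarrow> \<forall>\<^sub>F s in at_right 0. p + s *\<^sub>R v \<in> \<Omega>"
proof -
  obtain r e \<gamma> where graph: "r > 0" "norm e = 1" "C2_function \<gamma>"
    "\<Omega> \<inter> ball p r = {x \<in> ball p r. below_graph e \<gamma> x < 0}"
    using dom p unfolding bounded_C2_domain_def C2_graph_at_def by blast
  define b where "b = below_graph e \<gamma>"
  have in\<Omega>: "x \<in> \<Omega> \<longleftrightarrow> b x < 0" if "x \<in> ball p r" for x
    using graph(4) that unfolding b_def by blast
  obtain \<gamma>' where \<gamma>': "(\<gamma> has_derivative \<gamma>') (at (p - (p \<bullet> e) *\<^sub>R e))"
    using graph(3) unfolding C2_function_def differentiable_on_def differentiable_def by blast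
  define b' where "b' h = \<gamma>' (h - (h \<bullet> e) *\<^sub>R e) - h \<bullet> e" for h
  have "((\<lambda>x. x - (x \<bullet> e) *\<^sub>R e) has_derivative (\<lambda>h. h - (h \<bullet> e) *\<^sub>R e)) (at p)"
    by (auto intro!: derivative_eq_intros)
  from has_derivative_compose[OF this \<gamma>']
  have b': "(b has_derivative b') (at p)"
    unfolding b_def below_graph_def [abs_def] b'_def [abs_def]
    by (auto intro!: derivative_eq_intros)
  interpret b': bounded_linear b' using b' by (rule has_derivative_bounded_linear)
  \<comment> \<open>If \<open>b\<close> were positive at \<open>p\<close>, it would be positive
    nearby and a neighbourhood of \<open>p\<close> would miss \<Omega>, although \<open>p\<close>
    lies in its closure.\<close>
  have "b p \<le> 0"
  proof (rule ccontr)
    assume "\<not> b p \<le> 0"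
    moreover have "isCont b p" using b' by (rule has_derivative_continuous)
    ultimately have "\<forall>\<^sub>F x in nhds p. 0 < b x"
      by (intro order_tendstoD(1)[of b "b p"]) (auto simp: isCont_def tendsto_at_iff_tendsto_nhds)
    moreover have "\<forall>\<^sub>F x in nhds p. x \<in> ball p r"
      using graph(1) by (intro eventually_nhds_in_open) auto
    ultimately have "\<forall>\<^sub>F x in nhds p. x \<notin> \<Omega>"
      by eventually_elim (use in\<Omega> in force)
    then obtain U where "open U" "p \<in> U" "U \<inter> \<Omega> = {}"
      unfolding eventually_nhds by blast
    then have "p \<notin> closure \<Omega>" using open_Int_closure_eq_empty by blast
    then show False using p by (simp add: frontier_def)
  qed
  show ?thesis
  proof (rule that[of "{v. b' v < 0}" e])
    show "open {v. b' v < 0}"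
      by (intro open_Collect_less continuous_intros b'.continuous_on)
    have "e \<bullet> e = 1" using graph(2) by (simp add: dot_square_norm)
    moreover have "\<gamma>' 0 = 0" using has_derivative_bounded_linear[OF \<gamma>'] by (simp add: linear_simps)
    ultimately show "e \<in> {v. b' v < 0}" by (simp add: b'_def)
    fix v assume "v \<in> {v. b' v < 0}"
    then have v: "b' v < 0" by simp
    have "((\<lambda>s. p + s *\<^sub>R v) has_derivative (\<lambda>s. s *\<^sub>R v)) (at 0)"
      by (auto intro!: derivative_eq_intros)
    moreover have "(b has_derivative b') (at (p + 0 *\<^sub>R v))" using b' by simp
    ultimately have "((\<lambda>s. b (p + s *\<^sub>R v)) has_derivative (\<lambda>s. b' (s *\<^sub>R v))) (at 0)"
      by (rule has_derivative_compose)
    then have "((\<lambda>s. b (p + s *\<^sub>R v)) has_field_derivative b' v) (at 0)"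
      by (rule has_derivative_imp_has_field_derivative) (simp add: b'.scaleR)
    from DERIV_neg_dec_right[OF this v] obtain d where
      d: "d > 0" "\<And>h. 0 < h \<Longrightarrow> h < d \<Longrightarrow> b (p + h *\<^sub>R v) < b p" by auto
    have "((\<lambda>s. p + s *\<^sub>R v) \<longlongrightarrow> p + 0 *\<^sub>R v) (at_right 0)"
      by (intro tendsto_intros)
    then have "\<forall>\<^sub>F s in at_right 0. p + s *\<^sub>R v \<in> ball p r"
      using graph(1) by (intro topological_tendstoD) auto
    moreover have "\<forall>\<^sub>F s in at_right 0. b (p + s *\<^sub>R v) < 0"
      by (rule eventually_at_rightI[OF _ d(1)]) (use d(2) \<open>b p \<le> 0\<close> in force)
    ultimately show "\<forall>\<^sub>F s in at_right 0. p + s *\<^sub>R v \<in> \<Omega>"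
      by eventually_elim (use in\<Omega> in blast)
  qed
qed

lemma has_derivative_unique_closure:
  fixes f :: "real^'d \<Rightarrow> 'b::real_normed_vector"
  assumes dom: "bounded_C2_domain \<Omega>" and x: "x \<in> closure \<Omega>"
    and D: "(f has_derivative D) (at x within closure \<Omega>)"
    and E: "(f has_derivative E) (at x within closure \<Omega>)"
  shows "D = E"
proof (cases "x \<in> \<Omega>")
  case True
  have "open \<Omega>" using dom by (simp add: bounded_C2_domain_def)
  then have "x \<in> interior (closure \<Omega>)"
    using True by (meson closure_subset interiorI)
  then have "at x within closure \<Omega> = at x" by (rule at_within_interior)
  then show ?thesis using has_derivative_unique D E by metis
next
  case False
  then have "x \<in> frontier \<Omega>"
    using x dom by (simp add: frontier_def bounded_C2_domain_def interior_open)
  then obtain V v0 where V: "open V" "v0 \<in> V"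
    "\<And>v. v \<in> V \<Longrightarrow> \<forall>\<^sub>F s in at_right 0. x + s *\<^sub>R v \<in> \<Omega>"
    using bounded_C2_domain_cone[OF dom] by blast
  show ?thesis
    by (rule has_derivative_within_unique_cone[OF D E V(1,2)])
      (use V(3) closure_subset in \<open>blast intro: eventually_mono\<close>)
qed

text \<open>Uniqueness identifies a derivative produced by the chain rule with the one that
  \<open>frechet_derivative\<close> chooses, so \<open>partial_deriv\<close> can be computed at
  frontier points too.\<close>

lemma partial_deriv_closure_eq:
  assumes "bounded_C2_domain \<Omega>" "x \<in> closure \<Omega>" "(f has_derivative D) (at x within closure \<Omega>)"
  shows "partial_deriv (closure \<Omega>) k f x = D (axis k 1)"
proof -
  have "(f has_derivative frechet_derivative f (at x within closure \<Omega>)) (at x within closure \<Omega>)"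
    using assms(3) frechet_derivative_works differentiable_def by blast
  then show ?thesis
    using has_derivative_unique_closure[OF assms(1,2) assms(3)] by (simp add: partial_deriv_def)
qed

subsection \<open>The roots of the secular equation\<close>

text \<open>Since \<open>u\<close> vanishes at \<open>p\<close>, it is of first order in
  \<open>q - p\<close>, and the variation of a merely continuous \<open>w\<close> contributes only
  at higher order. Below, \<open>w\<close> contains the very root whose differentiability is to be
  proved.\<close>

lemma has_derivative_mult_vanishing:
  fixes u w :: "'a::real_normed_vector \<Rightarrow> real"
  assumes u: "(u has_derivative u') (at p within S)" and "u p = 0"
    and w: "continuous (at p within S) w"
  shows "((\<lambda>q. u q * w q) has_derivative (\<lambda>h. u' h * w p)) (at p within S)"
proof -
  interpret u': bounded_linear u' using u by (rule has_derivative_bounded_linear)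
  have w_lim: "(w \<longlongrightarrow> w p) (at p within S)" using w by (simp add: continuous_within)
  have rem: "((\<lambda>q. norm (u q - u p - u' (q - p)) / norm (q - p)) \<longlongrightarrow> 0) (at p within S)"
    using u unfolding has_derivative_iff_norm by blast
  obtain K where K: "\<And>h. norm (u' h) \<le> norm h * K" using u'.bounded by blast
  have "((\<lambda>q. norm (u q - u p - u' (q - p)) / norm (q - p) * \<bar>w q\<bar> + K * \<bar>w q - w p\<bar>)
      \<longlongrightarrow> 0 * \<bar>w p\<bar> + K * \<bar>w p - w p\<bar>) (at p within S)"
    by (intro tendsto_intros rem w_lim)
  then have lim: "((\<lambda>q. norm (u q - u p - u' (q - p)) / norm (q - p) * \<bar>w q\<bar> + K * \<bar>w q - w p\<bar>)
      \<longlongrightarrow> 0) (at p within S)" by simp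
  have bound: "norm (norm (u q * w q - u p * w p - u' (q - p) * w p) / norm (q - p))
      \<le> norm (u q - u p - u' (q - p)) / norm (q - p) * \<bar>w q\<bar> + K * \<bar>w q - w p\<bar>" if "q \<noteq> p" for q
  proof -
    have "u q * w q - u p * w p - u' (q - p) * w p =
        (u q - u p - u' (q - p)) * w q + u' (q - p) * (w q - w p)"
      using \<open>u p = 0\<close> by (simp add: algebra_simps)
    then have "norm (u q * w q - u p * w p - u' (q - p) * w p)
        \<le> norm (u q - u p - u' (q - p)) * \<bar>w q\<bar> + norm (u' (q - p)) * \<bar>w q - w p\<bar>"
      by (metis abs_mult norm_triangle_ineq real_norm_def)
    also have "\<dots> \<le> norm (u q - u p - u' (q - p)) * \<bar>w q\<bar> + norm (q - p) * K * \<bar>w q - w p\<bar>"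
      by (intro add_left_mono mult_right_mono K) auto
    finally show ?thesis using that by (simp add: divide_simps mult_ac)
  qed
  have "((\<lambda>q. norm (u q * w q - u p * w p - u' (q - p) * w p) / norm (q - p)) \<longlongrightarrow> 0)
      (at p within S)"
    by (rule Lim_null_comparison[OF eventually_mono[OF eventually_neq_at_within bound] lim])
  then show ?thesis
    unfolding has_derivative_iff_norm
    by (intro conjI bounded_linear_mult_const u'.bounded_linear_axioms)
qed

section \<open>The secular function on the gaps between the speeds\<close>

locale speeds =
  fixes N :: nat and g :: "nat \<Rightarrow> real"
  assumes N2: "N \<ge> 2" and g1: "0 < g 1" and mono: "strict_mono_on {1..N} g"
begin

text \<open>For positive \<open>y\<close> its zeros are the eigenvalues of the diagonal matrix of
  the \<open>g i\<close> compressed to the hyperplane orthogonal to the vector with entries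
  \<open>sqrt (y i)\<close>.\<close>

definition secular :: "(nat \<Rightarrow> real) \<Rightarrow> real \<Rightarrow> real" where
  "secular y \<zeta> = (\<Sum>i=1..N. y i / (g i - \<zeta>))"

lemma g_pos:
  assumes "i \<in> {1..N}"
  shows "0 < g i"
proof -
  have "g 1 \<le> g i"
    using assms mono N2 by (intro strict_mono_on_leD[OF mono]) auto
  then show ?thesis using g1 by linarith
qed

lemma gap_less:
  assumes "j \<in> {1..N-1}"
  shows "g j < g (Suc j)"
  using assms by (intro strict_mono_onD[OF mono]) auto

text \<open>No \<open>g i\<close> lies strictly inside a gap, so \<open>g i\<close> is on the same
  side of both points. Allowing two different points makes the divided differences of the secular
  function positive, not just its derivative.\<close>

lemma gap_mult_pos:
  assumes "j \<in> {1..N-1}" "i \<in> {1..N}" "\<zeta> \<in> {g j<..<g (Suc j)}" "\<xi> \<in> {g j<..<g (Suc j)}"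
  shows "0 < (g i - \<zeta>) * (g i - \<xi>)"
proof (cases "i \<le> j")
  case True
  have "g i \<le> g j"
    using True assms by (intro strict_mono_on_leD[OF mono]) auto
  then show ?thesis using assms by (intro mult_neg_neg) auto
next
  case False
  have "g (Suc j) \<le> g i"
    using False assms by (intro strict_mono_on_leD[OF mono]) auto
  then show ?thesis using assms by (intro mult_pos_pos) auto
qed

lemma gap_nonzero:
  assumes "j \<in> {1..N-1}" "i \<in> {1..N}" "\<zeta> \<in> {g j<..<g (Suc j)}"
  shows "g i - \<zeta> \<noteq> 0"
  using gap_mult_pos[OF assms assms(3)] by auto

lemma sum_pos_gap:
  assumes "j \<in> {1..N-1}" "\<zeta> \<in> {g j<..<g (Suc j)}" "\<xi> \<in> {g j<..<g (Suc j)}"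
    and "\<And>i. i \<in> {1..N} \<Longrightarrow> 0 < y i"
  shows "0 < (\<Sum>i=1..N. y i / ((g i - \<zeta>) * (g i - \<xi>)))"
  using N2 assms gap_mult_pos[OF assms(1) _ assms(2,3)] by (intro sum_pos divide_pos_pos) auto

text \<open>The resolvent identity for \<open>1 / (g i - \<zeta>)\<close>. With equal weights it
  yields monotonicity and, at two roots, orthogonality; with different weights it controls the
  increment of a root.\<close>

lemma secular_diff:
  assumes "\<And>i. i \<in> {1..N} \<Longrightarrow> g i - \<zeta> \<noteq> 0" "\<And>i. i \<in> {1..N} \<Longrightarrow> g i - \<xi> \<noteq> 0"
  shows "secular y \<zeta> - secular w \<xi> =
    (\<Sum>i=1..N. (y i - w i) / (g i - \<xi>)) + (\<zeta> - \<xi>) * (\<Sum>i=1..N. y i / ((g i - \<zeta>) * (g i - \<xi>)))"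
proof -
  have "y i / (g i - \<zeta>) - w i / (g i - \<xi>) =
      (y i - w i) / (g i - \<xi>) + (\<zeta> - \<xi>) * (y i / ((g i - \<zeta>) * (g i - \<xi>)))"
    if "i \<in> {1..N}" for i
    using assms[OF that] by (simp add: divide_simps) (simp add: algebra_simps)
  then show ?thesis
    by (simp add: secular_def sum_subtractf [symmetric] sum.distrib [symmetric] sum_distrib_left)
qed

lemma secular_strict_mono:
  assumes "j \<in> {1..N-1}" "\<zeta> \<in> {g j<..<g (Suc j)}" "\<xi> \<in> {g j<..<g (Suc j)}" "\<xi> < \<zeta>"
    and "\<And>i. i \<in> {1..N} \<Longrightarrow> 0 < y i"
  shows "secular y \<xi> < secular y \<zeta>"
proof -
  have "secular y \<zeta> - secular y \<xi> = (\<zeta> - \<xi>) * (\<Sum>i=1..N. y i / ((g i - \<zeta>) * (g i - \<xi>)))"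
    using secular_diff[of \<zeta> \<xi> y y] gap_nonzero assms by simp
  also have "\<dots> > 0"
    using assms sum_pos_gap[OF assms(1-3), of y] by simp
  finally show ?thesis by simp
qed

text \<open>Multiplying by the distances to both ends of the gap removes the two adjacent poles. The
  resulting \<open>h\<close> is continuous on the closed gap with values of opposite sign at its
  ends, so the intermediate value theorem applies.\<close>

lemma secular_root_exists:
  assumes j: "j \<in> {1..N-1}" and y: "\<And>i. i \<in> {1..N} \<Longrightarrow> 0 < y i"
  shows "\<exists>\<zeta>. \<zeta> \<in> {g j<..<g (Suc j)} \<and> secular y \<zeta> = 0"
proof -
  define a b where "a = g j" and "b = g (Suc j)"
  define K where "K = {1..N} - {j, Suc j}"
  define h where "h \<zeta> = - y j * (b - \<zeta>) + y (Suc j) * (\<zeta> - a)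
      + (b - \<zeta>) * (\<zeta> - a) * (\<Sum>i\<in>K. y i / (g i - \<zeta>))" for \<zeta>
  have jN: "j \<in> {1..N}" "Suc j \<in> {1..N}" using j by auto
  have ab: "a < b" unfolding a_def b_def by (rule gap_less[OF j])
  have nz: "g i - \<zeta> \<noteq> 0" if "i \<in> K" "\<zeta> \<in> {a..b}" for i \<zeta>
  proof (cases "i < j")
    case True
    then have "g i < a"
      using that j unfolding a_def K_def by (intro strict_mono_onD[OF mono]) auto
    then show ?thesis using that by auto
  next
    case False
    then have "b < g i"
      using that j unfolding b_def K_def by (intro strict_mono_onD[OF mono]) auto
    then show ?thesis using that by auto
  qed
  have "continuous_on {a..b} h"
    unfolding h_def using nz by (intro continuous_intros) auto
  moreover have "h a < 0" "0 < h b"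
    using ab y jN by (auto simp: h_def)
  ultimately obtain \<zeta> where \<zeta>: "\<zeta> \<in> {a..b}" "h \<zeta> = 0"
    using IVT'[of h a 0 b] ab by auto
  have "\<zeta> \<noteq> a" "\<zeta> \<noteq> b" using \<zeta>(2) \<open>h a < 0\<close> \<open>0 < h b\<close> by auto
  then have ineq: "a < \<zeta>" "\<zeta> < b" using \<zeta>(1) by auto
  have "secular y \<zeta> = y j / (a - \<zeta>) + (y (Suc j) / (b - \<zeta>) + (\<Sum>i\<in>K. y i / (g i - \<zeta>)))"
    unfolding secular_def a_def b_def K_def using jN
    by (simp add: sum.remove[of _ j] sum.remove[of _ "Suc j"] Diff_insert [symmetric] insert_commute)
  also have "\<dots> = h \<zeta> / ((b - \<zeta>) * (\<zeta> - a))"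
  proof -
    have "y j / (a - \<zeta>) = - y j * (b - \<zeta>) / ((b - \<zeta>) * (\<zeta> - a))"
      using ineq by (simp add: divide_simps) (simp add: algebra_simps)
    moreover have "y (Suc j) / (b - \<zeta>) = y (Suc j) * (\<zeta> - a) / ((b - \<zeta>) * (\<zeta> - a))"
      using ineq by (simp add: divide_simps)
    ultimately show ?thesis
      using ineq by (simp add: h_def add_divide_distrib diff_divide_distrib)
  qed
  finally show ?thesis using ineq \<zeta>(2) unfolding a_def b_def by auto
qed

lemma root_var_unique:
  assumes j: "j \<in> {1..N-1}" and y: "\<And>i. i \<in> {1..N} \<Longrightarrow> 0 < y i"
  shows "\<exists>!\<zeta>. \<zeta> \<in> {g j<..<g (Suc j)} \<and> secular y \<zeta> = 0"
proof -
  have "\<zeta> = \<xi>" if "\<zeta> \<in> {g j<..<g (Suc j)} \<and> secular y \<zeta> = 0"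
    "\<xi> \<in> {g j<..<g (Suc j)} \<and> secular y \<xi> = 0" for \<zeta> \<xi>
    using secular_strict_mono[OF j, of \<zeta> \<xi> y] secular_strict_mono[OF j, of \<xi> \<zeta> y] that y
    by (metis less_irrefl linorder_neqE_linordered_idom)
  then show ?thesis using secular_root_exists[OF j, of y, OF y] by blast
qed

lemma root_var:
  assumes "j \<in> {1..N-1}" and "\<And>i. i \<in> {1..N} \<Longrightarrow> 0 < y i"
  shows root_var_gap: "root_var N g j y \<in> {g j<..<g (Suc j)}"
    and secular_root_var: "secular y (root_var N g j y) = 0"
  using theI'[OF root_var_unique[of j y, OF assms]]
  unfolding root_var_def secular_def by auto

text \<open>By monotonicity, the sign of the secular function at a fixed point \<xi> tells on which
  side of \<xi> the root lies. The value at \<xi> depends continuously on the weights, so strict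
  bounds on the root persist near \<open>p\<close>.\<close>

lemma continuous_root_var:
  fixes Y :: "'a::real_normed_vector \<Rightarrow> nat \<Rightarrow> real"
  assumes j: "j \<in> {1..N-1}" and p: "p \<in> S"
    and pos: "\<And>q i. q \<in> S \<Longrightarrow> i \<in> {1..N} \<Longrightarrow> 0 < Y q i"
    and cont: "\<And>i. i \<in> {1..N} \<Longrightarrow> continuous (at p within S) (\<lambda>q. Y q i)"
  shows "continuous (at p within S) (\<lambda>q. root_var N g j (Y q))"
proof -
  define \<zeta> where "\<zeta> q = root_var N g j (Y q)" for q
  have gap: "\<zeta> q \<in> {g j<..<g (Suc j)}" and root: "secular (Y q) (\<zeta> q) = 0" if "q \<in> S" for q
    using root_var[OF j, of "Y q"] pos[OF that] unfolding \<zeta>_def by blast+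
  have lim: "((\<lambda>q. secular (Y q) \<xi>) \<longlongrightarrow> secular (Y p) \<xi>) (at p within S)"
    if "\<xi> \<in> {g j<..<g (Suc j)}" for \<xi>
    unfolding secular_def
    using cont gap_nonzero[OF j _ that] by (intro tendsto_intros) (auto simp: continuous_within)
  have inS: "\<forall>\<^sub>F q in at p within S. q \<in> S"
    by (simp add: eventually_at_topological) blast
  have "(\<zeta> \<longlongrightarrow> \<zeta> p) (at p within S)"
  proof (rule order_tendstoI)
    fix c assume c: "c < \<zeta> p"
    \<comment> \<open>The bound \<open>c\<close> may lie below the gap; the maximum with a midpoint
      gives a test point inside the gap, still to the left of the root.\<close>
    define \<xi> where "\<xi> = max c ((g j + \<zeta> p) / 2)"
    have \<xi>: "\<xi> \<in> {g j<..<g (Suc j)}" "\<xi> < \<zeta> p" "c \<le> \<xi>"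
      using gap[OF p] c by (auto simp: \<xi>_def less_max_iff_disj min_less_iff_disj)
    have "secular (Y p) \<xi> < 0"
      using secular_strict_mono[OF j gap[OF p] \<xi>(1,2), of "Y p"] pos[OF p] root[OF p] by simp
    then have "\<forall>\<^sub>F q in at p within S. secular (Y q) \<xi> < 0"
      by (rule order_tendstoD[OF lim[OF \<xi>(1)]])
    with inS show "\<forall>\<^sub>F q in at p within S. c < \<zeta> q"
    proof eventually_elim
      case (elim q)
      have "\<xi> < \<zeta> q"
        using secular_strict_mono[OF j \<xi>(1) gap, of q "Y q"] pos root elim
        by (metis less_asym less_irrefl linorder_neqE_linordered_idom)
      then show ?case using \<xi>(3) by simp
    qed
  next
    fix c assume c: "\<zeta> p < c"
    define \<xi> where "\<xi> = min c ((g (Suc j) + \<zeta> p) / 2)"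
    have \<xi>: "\<xi> \<in> {g j<..<g (Suc j)}" "\<zeta> p < \<xi>" "\<xi> \<le> c"
      using gap[OF p] c by (auto simp: \<xi>_def less_max_iff_disj min_less_iff_disj)
    have "0 < secular (Y p) \<xi>"
      using secular_strict_mono[OF j \<xi>(1) gap[OF p] \<xi>(2), of "Y p"] pos[OF p] root[OF p] by simp
    then have "\<forall>\<^sub>F q in at p within S. 0 < secular (Y q) \<xi>"
      by (rule order_tendstoD[OF lim[OF \<xi>(1)]])
    with inS show "\<forall>\<^sub>F q in at p within S. \<zeta> q < c"
    proof eventually_elim
      case (elim q)
      have "\<zeta> q < \<xi>"
        using secular_strict_mono[OF j gap \<xi>(1), of q "Y q"] pos root elim
        by (metis less_asym less_irrefl linorder_neqE_linordered_idom)
      then show ?case using \<xi>(3) by simp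
    qed
  qed
  then show ?thesis by (simp add: continuous_within \<zeta>_def [abs_def])
qed

text \<open>
  The implicit function theorem does not apply at boundary points of \<open>S\<close>. Instead, \<open>secular_diff\<close>
  expresses the increment of the root exactly as a quotient whose numerator is differentiable and
  vanishes at \<open>p\<close>, and whose denominator is continuous.
\<close>

lemma has_derivative_root_var:
  fixes Y :: "'a::real_normed_vector \<Rightarrow> nat \<Rightarrow> real"
  assumes j: "j \<in> {1..N-1}" and p: "p \<in> S"
    and pos: "\<And>q i. q \<in> S \<Longrightarrow> i \<in> {1..N} \<Longrightarrow> 0 < Y q i"
    and deriv: "\<And>i. i \<in> {1..N} \<Longrightarrow> ((\<lambda>q. Y q i) has_derivative Y' i) (at p within S)"
  defines "\<zeta> \<equiv> \<lambda>q. root_var N g j (Y q)"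
  shows "(\<zeta> has_derivative (\<lambda>h. - (\<Sum>i=1..N. Y' i h / (g i - \<zeta> p))
      / (\<Sum>i=1..N. Y p i / (g i - \<zeta> p)\<^sup>2))) (at p within S)"
proof -
  have gap: "\<zeta> q \<in> {g j<..<g (Suc j)}" and root: "secular (Y q) (\<zeta> q) = 0" if "q \<in> S" for q
    using root_var[OF j, of "Y q"] pos[OF that] unfolding \<zeta>_def by blast+
  note nz = gap_nonzero[OF j _ gap]
  define u where "u q = (\<Sum>i=1..N. (Y q i - Y p i) / (g i - \<zeta> p))" for q
  \<comment> \<open>This divided difference takes the place of the derivative of the secular
    function: it is positive, continuous at \<open>p\<close>, and becomes the slope when
    \<open>q = p\<close>.\<close>
  define H where "H q = (\<Sum>i=1..N. Y q i / ((g i - \<zeta> q) * (g i - \<zeta> p)))" for q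
  have H_pos: "H q > 0" if "q \<in> S" for q
    unfolding H_def using sum_pos_gap[OF j gap[OF that] gap[OF p]] pos[OF that] by auto
  have u: "(u has_derivative (\<lambda>h. \<Sum>i=1..N. Y' i h / (g i - \<zeta> p))) (at p within S)"
    unfolding u_def divide_inverse
    by (auto intro!: derivative_eq_intros deriv)
  have Y_cont: "continuous (at p within S) (\<lambda>q. Y q i)" if "i \<in> {1..N}" for i
    using deriv[OF that] by (rule has_derivative_continuous)
  have \<zeta>_cont: "continuous (at p within S) \<zeta>"
    unfolding \<zeta>_def by (rule continuous_root_var[OF j p pos Y_cont])
  have H_cont: "continuous (at p within S) H"
    unfolding H_def continuous_within using nz p
    by (intro tendsto_intros Y_cont[unfolded continuous_within] \<zeta>_cont[unfolded continuous_within]) auto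
  have "((\<lambda>q. u q * (- inverse (H q))) has_derivative
      (\<lambda>h. (\<Sum>i=1..N. Y' i h / (g i - \<zeta> p)) * (- inverse (H p)))) (at p within S)"
  proof (rule has_derivative_mult_vanishing[OF u])
    show "u p = 0" by (simp add: u_def)
    show "continuous (at p within S) (\<lambda>q. - inverse (H q))"
      using H_pos[OF p] H_cont by (auto simp: continuous_within intro!: tendsto_intros)
  qed
  then have quot: "((\<lambda>q. \<zeta> p + u q * (- inverse (H q))) has_derivative
      (\<lambda>h. 0 + (\<Sum>i=1..N. Y' i h / (g i - \<zeta> p)) * (- inverse (H p)))) (at p within S)"
    by (intro has_derivative_add has_derivative_const)
  have eq: "\<zeta> q = \<zeta> p + u q * (- inverse (H q))" if "q \<in> S" for q
  proof -
    have "0 = u q + (\<zeta> q - \<zeta> p) * H q"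
      using secular_diff[of "\<zeta> q" "\<zeta> p" "Y q" "Y p"] nz p that root unfolding u_def H_def by auto
    then show ?thesis using H_pos[OF that] by (simp add: field_simps)
  qed
  show ?thesis
    using has_derivative_transform[OF p eq quot]
    by (simp add: H_def power2_eq_square divide_inverse)
qed

end

subsection \<open>Root variables and fluxes\<close>

text \<open>The system consists of Cauchy rows, one for each node in \<open>Z\<close>, and a row of
  ones for a node at infinity; it is square and nonsingular. It serves to identify a flux vector by
  its total and its moments at the roots.\<close>

lemma cauchy_system_zero:
  fixes D a :: "'i \<Rightarrow> real" and Z :: "real set"
  assumes fin: "finite I" and inj: "inj_on a I" and Z: "finite Z" "card I = Suc (card Z)"
    and nz: "\<And>i \<zeta>. i \<in> I \<Longrightarrow> \<zeta> \<in> Z \<Longrightarrow> a i \<noteq> \<zeta>"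
    and zero: "(\<Sum>i\<in>I. D i) = 0" "\<And>\<zeta>. \<zeta> \<in> Z \<Longrightarrow> (\<Sum>i\<in>I. D i / (a i - \<zeta>)) = 0"
    and i: "i \<in> I"
  shows "D i = 0"
proof -
  \<comment> \<open>Clearing denominators yields a polynomial of degree less than \<open>card Z\<close> that vanishes on \<open>Z\<close>.\<close>
  define q where "q i = (\<Prod>l\<in>I - {i}. [:- a l, 1:])" for i
  define p where "p = (\<Sum>i\<in>I. smult (D i) (q i))"
  have deg_q: "degree (q i) = card Z" if "i \<in> I" for i
    unfolding q_def using that fin Z(2) by (subst degree_prod_eq_sum_degree) auto
  have lead_q: "coeff (q i) (card Z) = 1" if "i \<in> I" for i
    using deg_q[OF that] lead_coeff_prod[of "\<lambda>l. [:- a l, 1:]" "I - {i}"] unfolding q_def by simp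
  have poly_q: "poly (q i) \<zeta> = (\<Prod>l\<in>I - {i}. \<zeta> - a l)" for i \<zeta>
    by (simp add: q_def poly_prod)
  have "p = 0"
  proof (rule ccontr)
    assume p: "p \<noteq> 0"
    \<comment> \<open>Each \<open>q i\<close> is monic of degree \<open>card Z\<close>, so the top
      coefficient of \<open>p\<close> is the sum of the \<open>D i\<close>. This lowers the degree
      below the number of prescribed zeros.\<close>
    have "coeff p (card Z) = 0"
      using zero(1) lead_q by (simp add: p_def coeff_sum)
    moreover have "degree p \<le> card Z"
      unfolding p_def by (intro degree_sum_le fin) (simp add: deg_q)
    ultimately have "degree p < card Z"
      using p by (metis leading_coeff_0_iff order_le_less)
    moreover have "Z \<subseteq> {\<zeta>. poly p \<zeta> = 0}"
    proof
      fix \<zeta> assume \<zeta>: "\<zeta> \<in> Z"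
      have "poly (q i) \<zeta> = - (\<Prod>l\<in>I. \<zeta> - a l) / (a i - \<zeta>)" if "i \<in> I" for i
        using nz[OF that \<zeta>] that fin by (simp add: poly_q prod.remove[of I i] field_simps)
      then have "poly p \<zeta> = - (\<Prod>l\<in>I. \<zeta> - a l) * (\<Sum>i\<in>I. D i / (a i - \<zeta>))"
        by (simp add: p_def poly_sum sum_distrib_left mult_ac sum_negf)
      then show "\<zeta> \<in> {\<zeta>. poly p \<zeta> = 0}" using zero(2)[OF \<zeta>] by simp
    qed
    then have "card Z \<le> card {\<zeta>. poly p \<zeta> = 0}"
      by (intro card_mono poly_roots_finite p)
    ultimately show False
      using card_poly_roots_bound[OF p] by simp
  qed
  have "poly p (a i) = (\<Sum>k\<in>I. D k * (\<Prod>l\<in>I - {k}. a i - a l))"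
    by (simp add: p_def poly_sum poly_q)
  also have "\<dots> = (\<Sum>k\<in>I. if k = i then D i * (\<Prod>l\<in>I - {i}. a i - a l) else 0)"
    using fin i by (intro sum.cong) auto
  also have "\<dots> = D i * (\<Prod>l\<in>I - {i}. a i - a l)"
    using fin i by simp
  finally show ?thesis
    using \<open>p = 0\<close> fin i inj by (auto simp: inj_on_def)
qed

section \<open>Algebra of the roots at a fixed state\<close>

locale interlaced_roots = speeds +
  fixes y z :: "nat \<Rightarrow> real"
  assumes y_pos: "\<And>i. i \<in> {1..N} \<Longrightarrow> 0 < y i"
    and gap: "\<And>k. k \<in> {1..N-1} \<Longrightarrow> z k \<in> {g k<..<g (Suc k)}"
    and root: "\<And>k. k \<in> {1..N-1} \<Longrightarrow> secular y (z k) = 0"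
begin

text \<open>This is the derivative of \<open>secular y\<close> at \<open>z k\<close>, and also the
  squared norm of the vector with entries \<open>y i / (g i - z k)\<close> for the weight
  \<open>1 / y i\<close>.\<close>

definition slope where "slope k = (\<Sum>i=1..N. y i / (g i - z k)\<^sup>2)"

lemma nz: "k \<in> {1..N-1} \<Longrightarrow> i \<in> {1..N} \<Longrightarrow> g i - z k \<noteq> 0"
  using gap_nonzero gap by blast

lemma slope_pos: "k \<in> {1..N-1} \<Longrightarrow> 0 < slope k"
  using sum_pos_gap[of k "z k" "z k" y] gap y_pos by (simp add: slope_def power2_eq_square)

lemma z_strict_mono: "strict_mono_on {1..N-1} z"
proof (rule strict_mono_onI)
  fix k l assume kl: "k \<in> {1..N-1}" "l \<in> {1..N-1}" "k < l"
  then have "g (Suc k) \<le> g l"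
    by (intro strict_mono_on_leD[OF mono]) auto
  then show "z k < z l" using gap[OF kl(1)] gap[OF kl(2)] by auto
qed

lemma z_neq: "k \<in> {1..N-1} \<Longrightarrow> l \<in> {1..N-1} \<Longrightarrow> k \<noteq> l \<Longrightarrow> z k \<noteq> z l"
  using strict_mono_on_imp_inj_on[OF z_strict_mono] by (auto simp: inj_on_def)

lemma z_pos:
  assumes "k \<in> {1..N-1}"
  shows "0 < z k"
proof -
  have "k \<in> {1..N}" using assms by auto
  then show ?thesis using gap[OF assms] g_pos[of k] by auto
qed

text \<open>Subtracting the secular equations at two distinct roots leaves \<open>z k - z l\<close>
  times this sum.\<close>

lemma orthogonal:
  assumes "k \<in> {1..N-1}" "l \<in> {1..N-1}" "k \<noteq> l"
  shows "(\<Sum>i=1..N. y i / ((g i - z k) * (g i - z l))) = 0"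
  using secular_diff[of "z k" "z l" y y] nz assms root z_neq by simp

text \<open>The vectors with entries \<open>y i / (g i - z k)\<close> are an orthogonal basis of the
  zero-sum vectors for the weight \<open>1 / y i\<close>, and \<open>V k\<close> is the coefficient
  of the flux in it. The difference of the two sides has zero total and zero moments at all roots,
  so it vanishes.\<close>

lemma flux_expansion:
  assumes J0: "(\<Sum>i=1..N. J i) = 0" and V: "V = (\<lambda>k. (\<Sum>i=1..N. J i / (g i - z k)) / slope k)"
    and i: "i \<in> {1..N}"
  shows "J i = y i * (\<Sum>k=1..N-1. V k / (g i - z k))"
proof -
  define D where "D i = J i - y i * (\<Sum>k=1..N-1. V k / (g i - z k))" for i
  have y_sum: "(\<Sum>i=1..N. y i * (\<Sum>k=1..N-1. V k * w i k)) = (\<Sum>k=1..N-1. V k * (\<Sum>i=1..N. y i * w i k))" for w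
    unfolding sum_distrib_left by (subst sum.swap) (simp add: mult_ac)
  have "D i = 0"
  proof (rule cauchy_system_zero[of "{1..N}" g "z ` {1..N-1}"])
    show "inj_on g {1..N}" by (rule strict_mono_on_imp_inj_on[OF mono])
    show "card {1..N} = Suc (card (z ` {1..N-1}))"
      using N2 card_image[OF strict_mono_on_imp_inj_on[OF z_strict_mono]] by simp
    show "(\<Sum>i=1..N. D i) = 0"
    proof -
      have "(\<Sum>i=1..N. D i) = - (\<Sum>k=1..N-1. V k * (\<Sum>i=1..N. y i * (1 / (g i - z k))))"
        using J0 y_sum[of "\<lambda>i k. 1 / (g i - z k)"] by (simp add: D_def sum_subtractf)
      then show ?thesis using root by (simp add: secular_def)
    qed
    fix \<zeta> assume "\<zeta> \<in> z ` {1..N-1}"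
    then obtain l where l: "l \<in> {1..N-1}" "\<zeta> = z l" by auto
    have "(\<Sum>i=1..N. D i / (g i - z l)) = (\<Sum>i=1..N. J i / (g i - z l))
        - (\<Sum>i=1..N. y i * (\<Sum>k=1..N-1. V k * (1 / ((g i - z k) * (g i - z l)))))"
      by (simp add: D_def diff_divide_distrib sum_subtractf sum_distrib_left sum_divide_distrib mult_ac)
    also have "\<dots> = V l * slope l - (\<Sum>k=1..N-1. V k * (\<Sum>i=1..N. y i * (1 / ((g i - z k) * (g i - z l)))))"
      using slope_pos[OF l(1)] by (simp only: y_sum) (simp add: V)
    also have "(\<Sum>k=1..N-1. V k * (\<Sum>i=1..N. y i * (1 / ((g i - z k) * (g i - z l)))))
        = (\<Sum>k=1..N-1. if k = l then V l * slope l else 0)"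
      using orthogonal[OF _ l(1)] by (intro sum.cong) (auto simp: slope_def power2_eq_square)
    also have "\<dots> = V l * slope l" using l by simp
    finally show "(\<Sum>i=1..N. D i / (g i - \<zeta>)) = 0" by (simp add: l)
  qed (use i nz in auto)
  then show ?thesis by (simp add: D_def)
qed

text \<open>A single point and a single coordinate direction: \<open>J\<close> and \<open>dy\<close>
  stand for the components of the fluxes and of the concentration gradients in that
  direction.\<close>

context
  fixes J dy :: "nat \<Rightarrow> real" and G \<Gamma> :: real
  assumes J0: "(\<Sum>i=1..N. J i) = 0" and y1: "(\<Sum>i=1..N. y i) = 1"
    and \<Gamma>: "\<Gamma> = (\<Sum>i=1..N. g i * J i)"
    and dy: "\<And>i. i \<in> {1..N} \<Longrightarrow> dy i = y i * \<Gamma> - (g i + G) * J i"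
    and G: "0 < G"
begin

text \<open>Split \<open>g i + G\<close> into \<open>g i - z j\<close> and \<open>z j + G\<close>.
  The first part yields the total flux, which is zero, and the term with \<Gamma> carries the
  secular function at its root.\<close>

lemma root_derivative_flux:
  assumes j: "j \<in> {1..N-1}"
  shows "- (\<Sum>i=1..N. dy i / (g i - z j)) = (z j + G) * (\<Sum>i=1..N. J i / (g i - z j))"
proof -
  have "dy i / (g i - z j) = \<Gamma> * (y i / (g i - z j)) - J i - (z j + G) * (J i / (g i - z j))"
    if "i \<in> {1..N}" for i
    using nz[OF j that] by (simp add: dy[OF that] divide_simps) (simp add: algebra_simps)
  then have "(\<Sum>i=1..N. dy i / (g i - z j)) = \<Gamma> * secular y (z j) - (\<Sum>i=1..N. J i)
      - (z j + G) * (\<Sum>i=1..N. J i / (g i - z j))"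
    by (simp add: secular_def sum_subtractf sum_distrib_left)
  then show ?thesis using J0 root[OF j] by simp
qed

text \<open>The left-hand side is what the quotient rule for \<open>P / slope j\<close> produces in
  one direction besides the derivatives of the fluxes; \<open>dS\<close> is the derivative of the
  slope. Expanding the fluxes turns it into products of root gradients.\<close>

lemma root_balance:
  assumes j: "j \<in> {1..N-1}"
  defines "\<Lambda> \<equiv> \<lambda>k. z k + G"
  defines "dz \<equiv> \<lambda>k. - (\<Sum>i=1..N. dy i / (g i - z k)) / slope k"
  defines "P \<equiv> \<Sum>i=1..N. J i / (g i - z j)"
    and "Q \<equiv> \<Sum>i=1..N. J i / (g i - z j)\<^sup>2"
    and "T \<equiv> \<Sum>i=1..N. y i / (g i - z j) ^ 3"
  defines "dS \<equiv> (\<Sum>i=1..N. dy i / (g i - z j)\<^sup>2) + 2 * T * dz j"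
  shows "Q * dz j / slope j - P * dS / (slope j)\<^sup>2 =
    (\<Sum>k\<in>{1..N-1} - {j}. (\<Lambda> j + \<Lambda> k) / (\<Lambda> j * \<Lambda> k * (\<Lambda> j - \<Lambda> k)) * (dz j * dz k))"
proof -
  define V where "V = (\<lambda>k. (\<Sum>i=1..N. J i / (g i - z k)) / slope k)"
  define K where "K = {1..N-1} - {j}"
  have dz: "dz k = \<Lambda> k * V k" if "k \<in> {1..N-1}" for k
    by (simp only: dz_def \<Lambda>_def V_def root_derivative_flux[OF that] times_divide_eq_right)
  have P: "P = slope j * V j" using slope_pos[OF j] by (simp add: V_def P_def)
  have split_j: "(\<Sum>k=1..N-1. c k) = c j + (\<Sum>k\<in>K. c k)" for c :: "nat \<Rightarrow> real"
    unfolding K_def using j by (intro sum.remove) auto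
  note J = flux_expansion[OF J0 V_def]

  \<comment> \<open>With \<open>g i / (g i - z k) = 1 + z k / (g i - z k)\<close>, the secular
    equation and the unit mass reduce \<Gamma> to the sum of the \<open>V k\<close>.\<close>
  have "\<Gamma> = (\<Sum>i=1..N. \<Sum>k=1..N-1. V k * (y i + z k * (y i / (g i - z k))))"
    unfolding \<Gamma>
  proof (intro sum.cong refl)
    fix i assume i: "i \<in> {1..N}"
    have "g i * J i = (\<Sum>k=1..N-1. g i * (y i * (V k / (g i - z k))))"
      by (simp add: J[OF i] sum_distrib_left)
    also have "\<dots> = (\<Sum>k=1..N-1. V k * (y i + z k * (y i / (g i - z k))))"
      using nz[OF _ i] by (intro sum.cong refl) (simp add: divide_simps, simp add: algebra_simps)
    finally show "g i * J i = (\<Sum>k=1..N-1. V k * (y i + z k * (y i / (g i - z k))))" .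
  qed
  also have "\<dots> = (\<Sum>k=1..N-1. V k * ((\<Sum>i=1..N. y i) + z k * secular y (z k)))"
    by (subst sum.swap) (simp add: sum.distrib secular_def sum_distrib_left ring_distribs)
  finally have \<Gamma>_V: "\<Gamma> = V j + (\<Sum>k\<in>K. V k)"
    using root y1 split_j[of V] by simp

  have "Q = (\<Sum>i=1..N. \<Sum>k=1..N-1. V k * (y i / ((g i - z k) * (g i - z j)\<^sup>2)))"
    unfolding Q_def by (intro sum.cong refl) (simp add: J sum_distrib_left sum_divide_distrib mult_ac)
  also have "\<dots> = (\<Sum>k=1..N-1. V k * (\<Sum>i=1..N. y i / ((g i - z k) * (g i - z j)\<^sup>2)))"
    by (subst sum.swap) (simp add: sum_distrib_left)
  also have "\<dots> = V j * T + (\<Sum>k\<in>K. V k * (slope j / (\<Lambda> j - \<Lambda> k)))"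
  proof -
    have "(\<Sum>i=1..N. y i / ((g i - z k) * (g i - z j)\<^sup>2)) = slope j / (\<Lambda> j - \<Lambda> k)" if k: "k \<in> K" for k
    proof -
      have k': "k \<in> {1..N-1}" "k \<noteq> j" using k by (auto simp: K_def)
      \<comment> \<open>Partial fractions: the sum becomes the slope at \<open>j\<close> minus a sum
        that vanishes by orthogonality.\<close>
      have "y i / ((g i - z k) * (g i - z j)\<^sup>2) =
          (y i / (g i - z j)\<^sup>2 - y i / ((g i - z k) * (g i - z j))) / (z j - z k)"
        if "i \<in> {1..N}" for i
        using nz[OF j that] nz[OF k'(1) that] z_neq[OF j k'(1)] k'(2)
        by (simp add: divide_simps power2_eq_square) (simp add: algebra_simps)
      then have "(\<Sum>i=1..N. y i / ((g i - z k) * (g i - z j)\<^sup>2)) =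
          (slope j - (\<Sum>i=1..N. y i / ((g i - z k) * (g i - z j)))) / (z j - z k)"
        by (simp add: slope_def sum_subtractf sum_divide_distrib [symmetric])
      then show ?thesis using orthogonal[OF k'(1) j k'(2)] by (simp add: \<Lambda>_def)
    qed
    then show ?thesis
      unfolding split_j by (simp add: T_def power2_eq_square power3_eq_cube mult_ac)
  qed
  finally have Q: "Q = V j * T + slope j * (\<Sum>k\<in>K. V k / (\<Lambda> j - \<Lambda> k))"
    by (simp add: sum_distrib_left mult_ac)

  \<comment> \<open>The splitting from \<open>root_derivative_flux\<close> again; the slope now
    replaces the secular function, and \<open>P\<close> the total flux.\<close>
  have "dy i / (g i - z j)\<^sup>2 =
      \<Gamma> * (y i / (g i - z j)\<^sup>2) - J i / (g i - z j) - \<Lambda> j * (J i / (g i - z j)\<^sup>2)"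
    if "i \<in> {1..N}" for i
    using nz[OF j that]
    by (simp add: dy[OF that] \<Lambda>_def divide_simps power2_eq_square) (simp add: algebra_simps)
  then have dS: "dS = \<Gamma> * slope j - P - \<Lambda> j * Q + 2 * T * dz j"
    by (simp add: dS_def slope_def P_def Q_def sum_subtractf sum_distrib_left)

  \<comment> \<open>Uses \<open>(\<Lambda> j + \<Lambda> k) / (\<Lambda> j - \<Lambda> k) = 2 *
    \<Lambda> j / (\<Lambda> j - \<Lambda> k) - 1\<close>.\<close>
  have "(\<Sum>k\<in>K. (\<Lambda> j + \<Lambda> k) / (\<Lambda> j * \<Lambda> k * (\<Lambda> j - \<Lambda> k)) * (dz j * dz k))
      = (\<Sum>k\<in>K. V j * (2 * \<Lambda> j * (V k / (\<Lambda> j - \<Lambda> k)) - V k))"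
  proof (intro sum.cong refl)
    fix k assume "k \<in> K"
    then have k: "k \<in> {1..N-1}" "k \<noteq> j" by (auto simp: K_def)
    have pos: "\<Lambda> j > 0" "\<Lambda> k > 0" using z_pos j k G by (auto simp: \<Lambda>_def intro!: add_pos_pos)
    have neq: "\<Lambda> j - \<Lambda> k \<noteq> 0" using z_neq[OF j k(1)] k by (simp add: \<Lambda>_def)
    show "(\<Lambda> j + \<Lambda> k) / (\<Lambda> j * \<Lambda> k * (\<Lambda> j - \<Lambda> k)) * (dz j * dz k)
        = V j * (2 * \<Lambda> j * (V k / (\<Lambda> j - \<Lambda> k)) - V k)"
      unfolding dz[OF j] dz[OF k(1)] using pos neq by (simp add: divide_simps) (simp add: algebra_simps)
  qed
  also have "\<dots> = V j * (2 * \<Lambda> j * (\<Sum>k\<in>K. V k / (\<Lambda> j - \<Lambda> k)) - (\<Sum>k\<in>K. V k))"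
    by (simp add: sum_subtractf sum_distrib_left right_diff_distrib mult_ac)
  \<comment> \<open>The terms with \<open>T\<close> and those with the square of \<open>V j\<close>
    cancel here.\<close>
  also have "\<dots> = Q * dz j / slope j - P * dS / (slope j)\<^sup>2"
    unfolding dS P Q \<Gamma>_V dz[OF j] using slope_pos[OF j]
    by (simp add: divide_simps power2_eq_square) (simp add: algebra_simps)
  finally show ?thesis by (simp add: K_def)
qed

end

end

subsection \<open>The root equations\<close>

text \<open>For additive coefficients the sums over all indices collapse by unit mass and zero total
  flux. The excluded index \<open>l = i\<close> leaves \<open>2 * g i * y i * J i\<close> in the
  diagonal and the off-diagonal part with opposite signs.\<close>

lemma (in speeds) MS_matrix_apply:
  assumes f: "\<And>l. l \<in> {1..N} \<Longrightarrow> l \<noteq> i \<Longrightarrow> f i l = g i + g l"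
    and y: "(\<Sum>l=1..N. y l) = 1" and J: "(\<Sum>l=1..N. J l) = 0" and i: "i \<in> {1..N}"
  shows "(\<Sum>l=1..N. MS_matrix N f y i l * J l) =
    y i * (\<Sum>l=1..N. g l * J l) - (g i + (\<Sum>l=1..N. g l * y l)) * J i"
proof -
  have off: "(\<Sum>l\<in>{1..N} - {i}. h l) = (\<Sum>l=1..N. h l) - h i" for h :: "nat \<Rightarrow> real"
    using i by (simp add: sum_diff1)
  have "(\<Sum>l\<in>{1..N} - {i}. f i l * y l) = (\<Sum>l\<in>{1..N} - {i}. g i * y l + g l * y l)"
    using f by (intro sum.cong refl) (auto simp: algebra_simps)
  also have "\<dots> = g i + (\<Sum>l=1..N. g l * y l) - 2 * g i * y i"
    unfolding off using y by (simp add: sum.distrib sum_distrib_left [symmetric])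
  finally have diag: "(\<Sum>l\<in>{1..N} - {i}. f i l * y l) = g i + (\<Sum>l=1..N. g l * y l) - 2 * g i * y i" .
  have "(\<Sum>l\<in>{1..N} - {i}. MS_matrix N f y i l * J l)
      = (\<Sum>l\<in>{1..N} - {i}. y i * (g i * J l) + y i * (g l * J l))"
    using f by (intro sum.cong refl) (auto simp: MS_matrix_def algebra_simps)
  also have "\<dots> = y i * (\<Sum>l=1..N. g l * J l) - 2 * y i * g i * J i"
    unfolding off using J by (simp add: sum.distrib sum_distrib_left [symmetric])
  finally have offdiag: "(\<Sum>l\<in>{1..N} - {i}. MS_matrix N f y i l * J l)
      = y i * (\<Sum>l=1..N. g l * J l) - 2 * y i * g i * J i" .
  have "(\<Sum>l=1..N. MS_matrix N f y i l * J l)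
      = MS_matrix N f y i i * J i + (\<Sum>l\<in>{1..N} - {i}. MS_matrix N f y i l * J l)"
    using i by (intro sum.remove) auto
  moreover have "MS_matrix N f y i i = 2 * g i * y i - (g i + (\<Sum>l=1..N. g l * y l))"
    unfolding MS_matrix_def diag by simp
  ultimately show ?thesis
    unfolding offdiag by (simp add: algebra_simps)
qed

text \<open>The quotient rule, arranged so that the derivatives of the numerators \<open>J i\<close>
  stand apart and the remaining terms match \<open>root_balance\<close>.\<close>

lemma has_derivative_sum_quotient:
  fixes J Y :: "nat \<Rightarrow> 'a::real_normed_vector \<Rightarrow> real"
  assumes J: "\<And>i. i \<in> A \<Longrightarrow> (J i has_derivative J' i) (at x)"
    and Y: "\<And>i. i \<in> A \<Longrightarrow> (Y i has_derivative Y' i) (at x)"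
    and \<zeta>: "(\<zeta> has_derivative \<zeta>') (at x)"
    and nz: "\<And>i. i \<in> A \<Longrightarrow> g i - \<zeta> x \<noteq> 0"
    and nz': "(\<Sum>i\<in>A. Y i x / (g i - \<zeta> x)\<^sup>2) \<noteq> 0"
  defines "S \<equiv> \<Sum>i\<in>A. Y i x / (g i - \<zeta> x)\<^sup>2"
  shows "((\<lambda>q. (\<Sum>i\<in>A. J i q / (g i - \<zeta> q)) / (\<Sum>i\<in>A. Y i q / (g i - \<zeta> q)\<^sup>2)) has_derivative
    (\<lambda>h. ((\<Sum>i\<in>A. J' i h / (g i - \<zeta> x)) + (\<Sum>i\<in>A. J i x / (g i - \<zeta> x)\<^sup>2) * \<zeta>' h) / S
       - (\<Sum>i\<in>A. J i x / (g i - \<zeta> x)) *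
         ((\<Sum>i\<in>A. Y' i h / (g i - \<zeta> x)\<^sup>2) + 2 * (\<Sum>i\<in>A. Y i x / (g i - \<zeta> x) ^ 3) * \<zeta>' h) / S\<^sup>2)) (at x)"
proof -
  have P: "((\<lambda>q. \<Sum>i\<in>A. J i q / (g i - \<zeta> q)) has_derivative
      (\<lambda>h. \<Sum>i\<in>A. J' i h / (g i - \<zeta> x) + J i x / (g i - \<zeta> x)\<^sup>2 * \<zeta>' h)) (at x)"
  proof (rule has_derivative_sum)
    fix i assume i: "i \<in> A"
    define c where "c = g i - \<zeta> x"
    have c: "c \<noteq> 0" using nz[OF i] by (simp add: c_def)
    have "((\<lambda>q. J i q / (g i - \<zeta> q)) has_derivative
        (\<lambda>h. (J' i h * (g i - \<zeta> x) - J i x * (0 - \<zeta>' h)) / ((g i - \<zeta> x) * (g i - \<zeta> x)))) (at x)"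
      by (intro has_derivative_divide' has_derivative_diff has_derivative_const J[OF i] \<zeta> nz[OF i])
    then show "((\<lambda>q. J i q / (g i - \<zeta> q)) has_derivative
        (\<lambda>h. J' i h / (g i - \<zeta> x) + J i x / (g i - \<zeta> x)\<^sup>2 * \<zeta>' h)) (at x)"
      by (rule has_derivative_eq_rhs)
        (use c in \<open>simp add: fun_eq_iff field_simps power2_eq_square flip: c_def\<close>)
  qed
  have S: "((\<lambda>q. \<Sum>i\<in>A. Y i q / (g i - \<zeta> q)\<^sup>2) has_derivative
      (\<lambda>h. \<Sum>i\<in>A. Y' i h / (g i - \<zeta> x)\<^sup>2 + 2 * (Y i x / (g i - \<zeta> x) ^ 3) * \<zeta>' h)) (at x)"
  proof (rule has_derivative_sum)
    fix i assume i: "i \<in> A"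
    define c where "c = g i - \<zeta> x"
    have c: "c \<noteq> 0" using nz[OF i] by (simp add: c_def)
    have "((\<lambda>q. Y i q / ((g i - \<zeta> q) * (g i - \<zeta> q))) has_derivative
        (\<lambda>h. (Y' i h * ((g i - \<zeta> x) * (g i - \<zeta> x))
            - Y i x * ((g i - \<zeta> x) * (0 - \<zeta>' h) + (0 - \<zeta>' h) * (g i - \<zeta> x)))
          / (((g i - \<zeta> x) * (g i - \<zeta> x)) * ((g i - \<zeta> x) * (g i - \<zeta> x))))) (at x)"
      using nz[OF i]
      by (intro has_derivative_divide' has_derivative_mult has_derivative_diff has_derivative_const Y[OF i] \<zeta>) auto
    then show "((\<lambda>q. Y i q / (g i - \<zeta> q)\<^sup>2) has_derivative
        (\<lambda>h. Y' i h / (g i - \<zeta> x)\<^sup>2 + 2 * (Y i x / (g i - \<zeta> x) ^ 3) * \<zeta>' h)) (at x)"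
      unfolding power2_eq_square
      by (rule has_derivative_eq_rhs)
        (use c in \<open>simp add: fun_eq_iff field_simps power3_eq_cube flip: c_def\<close>)
  qed
  have P': "((\<lambda>q. \<Sum>i\<in>A. J i q / (g i - \<zeta> q)) has_derivative
      (\<lambda>h. (\<Sum>i\<in>A. J' i h / (g i - \<zeta> x)) + (\<Sum>i\<in>A. J i x / (g i - \<zeta> x)\<^sup>2) * \<zeta>' h)) (at x)"
    by (rule has_derivative_eq_rhs[OF P]) (simp add: sum.distrib sum_distrib_right)
  have S': "((\<lambda>q. \<Sum>i\<in>A. Y i q / (g i - \<zeta> q)\<^sup>2) has_derivative
      (\<lambda>h. (\<Sum>i\<in>A. Y' i h / (g i - \<zeta> x)\<^sup>2) + 2 * (\<Sum>i\<in>A. Y i x / (g i - \<zeta> x) ^ 3) * \<zeta>' h)) (at x)"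
    by (rule has_derivative_eq_rhs[OF S]) (simp add: sum.distrib sum_distrib_left sum_distrib_right)
  have "(a * S - p * b) / (S * S) = a / S - p * b / S\<^sup>2" for a b p
    using nz' by (simp add: S_def [symmetric] diff_divide_distrib power2_eq_square)
  then show ?thesis
    using has_derivative_divide'[OF P' S' nz'] by (simp only: S_def)
qed

section \<open>The differential equations on the closed domain\<close>

locale MS_flow = speeds +
  fixes f :: "nat \<Rightarrow> nat \<Rightarrow> real" and I :: "real set" and \<Omega> :: "(real^'d) set"
    and \<nu> :: "real^'d \<Rightarrow> real^'d"
    and y :: "real \<Rightarrow> real^'d \<Rightarrow> nat \<Rightarrow> real" and J :: "real \<Rightarrow> real^'d \<Rightarrow> nat \<Rightarrow> real^'d"
  assumes f: "\<And>i j. i \<in> {1..N} \<Longrightarrow> j \<in> {1..N} \<Longrightarrow> i \<noteq> j \<Longrightarrow> f i j = g i + g j"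
    and domain: "bounded_C2_domain \<Omega>" and open_I: "open I"
    and simplex: "\<And>t x. t \<in> I \<Longrightarrow> x \<in> closure \<Omega> \<Longrightarrow> y t x \<in> open_simplex N"
    and solution: "classical_MS_solution N f I \<Omega> \<nu> y J"
begin

definition z where "z j t x = root_var N g j (y t x)"
definition G where "G t x = (\<Sum>i=1..N. g i * y t x i)"
definition dy where "dy t k i x = partial_deriv (closure \<Omega>) k (\<lambda>x'. y t x' i) x"
definition flux_mean where "flux_mean t k x = (\<Sum>i=1..N. g i * J t x i $ k)"
definition slope where "slope j t x = (\<Sum>i=1..N. y t x i / (g i - z j t x)\<^sup>2)"
definition flux_moment where "flux_moment j t k x = (\<Sum>i=1..N. J t x i $ k / (g i - z j t x))"

lemma open_domain: "open \<Omega>"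
  using domain by (simp add: bounded_C2_domain_def)

lemma at_within_domain: "x \<in> \<Omega> \<Longrightarrow> at x within closure \<Omega> = at x"
  using open_domain by (meson at_within_interior closure_subset interiorI)

lemma frontier_closure: "x \<in> frontier \<Omega> \<Longrightarrow> x \<in> closure \<Omega>"
  by (simp add: frontier_def)

lemma domain_closure: "x \<in> \<Omega> \<Longrightarrow> x \<in> closure \<Omega>"
  using closure_subset by blast

lemma y_pos: "t \<in> I \<Longrightarrow> x \<in> closure \<Omega> \<Longrightarrow> i \<in> {1..N} \<Longrightarrow> 0 < y t x i"
  and y_sum: "t \<in> I \<Longrightarrow> x \<in> closure \<Omega> \<Longrightarrow> (\<Sum>i=1..N. y t x i) = 1"
  using simplex unfolding open_simplex_def by blast+

lemma regularity:
  assumes "t \<in> I" "i \<in> {1..N}"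
  shows y_time_differentiable: "x \<in> \<Omega> \<Longrightarrow> (\<lambda>s. y s x i) differentiable (at t)"
    and y_differentiable: "(\<lambda>x. y t x i) differentiable_on closure \<Omega>"
    and dy_continuous: "continuous_on (closure \<Omega>) (dy t k i)"
    and dy_differentiable: "dy t k i differentiable_on \<Omega>"
    and J_continuous: "continuous_on (closure \<Omega>) (\<lambda>x. J t x i)"
proof -
  have reg: "classical_regularity I \<Omega> (\<lambda>t x. y t x i)"
    and "continuous_on (closure \<Omega>) (\<lambda>x. J t x i)"
    using solution assms unfolding classical_MS_solution_def by blast+
  then show "x \<in> \<Omega> \<Longrightarrow> (\<lambda>s. y s x i) differentiable (at t)"
    and "(\<lambda>x. y t x i) differentiable_on closure \<Omega>"
    and "continuous_on (closure \<Omega>) (\<lambda>x. J t x i)"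
    and "dy t k i differentiable_on \<Omega>"
    using assms(1) unfolding classical_regularity_def dy_def [abs_def] by blast+
  have "continuous_on (I \<times> closure \<Omega>) (\<lambda>(t, x). grad (closure \<Omega>) (\<lambda>x. y t x i) x)"
    using reg unfolding classical_regularity_def by blast
  moreover have "continuous_on (closure \<Omega>) (\<lambda>x. (t, x))"
    by (intro continuous_intros)
  ultimately have "continuous_on (closure \<Omega>) (\<lambda>x. (\<lambda>(t, x). grad (closure \<Omega>) (\<lambda>x. y t x i) x) (t, x))"
    by (rule continuous_on_compose2) (use assms(1) in blast)
  then have "continuous_on (closure \<Omega>) (\<lambda>x. grad (closure \<Omega>) (\<lambda>x. y t x i) x $ k)"
    unfolding prod.case by (rule continuous_on_component)
  then show "continuous_on (closure \<Omega>) (dy t k i)"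
    by (simp add: grad_def dy_def [abs_def])
qed

lemma y_differentiable_at:
  assumes "t \<in> I" "x \<in> \<Omega>" "i \<in> {1..N}"
  shows "(\<lambda>x. y t x i) differentiable (at x)"
  using y_differentiable[OF assms(1,3)] assms(2)
  by (metis at_within_domain differentiable_on_def domain_closure)

lemma conservation:
  assumes "t \<in> I" "x \<in> \<Omega>" "i \<in> {1..N}"
  shows "deriv (\<lambda>s. y s x i) t = - divergence (closure \<Omega>) (\<lambda>x'. J t x' i) x"
proof -
  have "deriv (\<lambda>s. y s x i) t + divergence (closure \<Omega>) (\<lambda>x'. J t x' i) x = 0"
    using solution assms unfolding classical_MS_solution_def by blast
  then show ?thesis by simp
qed

text \<open>The constraint is posed in \<Omega>; continuity of \<open>J\<close> carries it to the
  frontier, where the boundary condition for the roots uses it.\<close>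

lemma J_sum:
  assumes t: "t \<in> I" and x: "x \<in> closure \<Omega>"
  shows "(\<Sum>i=1..N. J t x i $ k) = 0"
proof (rule continuous_constant_on_closure[OF _ _ x])
  show "continuous_on (closure \<Omega>) (\<lambda>x. \<Sum>i=1..N. J t x i $ k)"
    by (intro continuous_intros continuous_on_component J_continuous t)
  fix x assume "x \<in> \<Omega>"
  then have "(\<Sum>i=1..N. J t x i) = 0"
    using solution t unfolding classical_MS_solution_def by blast
  then show "(\<Sum>i=1..N. J t x i $ k) = 0"
    by (metis sum_component zero_index)
qed

text \<open>In \<Omega> this is \<open>MS_matrix_apply\<close>; continuity of both sides extends it
  to the frontier.\<close>

lemma dy_flux:
  assumes t: "t \<in> I" and x: "x \<in> closure \<Omega>" and i: "i \<in> {1..N}"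
  shows "dy t k i x = y t x i * flux_mean t k x - (g i + G t x) * J t x i $ k"
proof -
  have "dy t k i x - (y t x i * flux_mean t k x - (g i + G t x) * J t x i $ k) = 0"
  proof (rule continuous_constant_on_closure[OF _ _ x])
    show "continuous_on (closure \<Omega>)
        (\<lambda>x. dy t k i x - (y t x i * flux_mean t k x - (g i + G t x) * J t x i $ k))"
      unfolding flux_mean_def G_def using i
      by (intro continuous_intros continuous_on_component J_continuous t dy_continuous
          differentiable_imp_continuous_on[OF y_differentiable])
    fix x assume x: "x \<in> \<Omega>"
    have "dy t k i x = (\<Sum>j=1..N. MS_matrix N f (y t x) i j * J t x j $ k)"
      using solution t x i unfolding classical_MS_solution_def dy_def by blast
    also have "\<dots> = y t x i * flux_mean t k x - (g i + G t x) * J t x i $ k"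
      unfolding flux_mean_def G_def using t x i f domain_closure
      by (intro MS_matrix_apply y_sum J_sum) auto
    finally show "dy t k i x - (y t x i * flux_mean t k x - (g i + G t x) * J t x i $ k) = 0"
      by simp
  qed
  then show ?thesis by simp
qed

lemma interlaced:
  assumes "t \<in> I" "x \<in> closure \<Omega>"
  shows "interlaced_roots N g (y t x) (\<lambda>k. z k t x)"
proof
  fix k assume k: "k \<in> {1..N-1}"
  show "z k t x \<in> {g k<..<g (Suc k)}" and "secular (y t x) (z k t x) = 0"
    unfolding z_def using root_var[OF k, of "y t x"] y_pos assms by blast+
qed (use y_pos assms in blast)

lemma slope_eq: "t \<in> I \<Longrightarrow> x \<in> closure \<Omega> \<Longrightarrow> slope j t x = interlaced_roots.slope N g (y t x) (\<lambda>k. z k t x) j"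
  by (simp add: slope_def interlaced_roots.slope_def[OF interlaced])

lemma G_pos:
  assumes "t \<in> I" "x \<in> closure \<Omega>"
  shows "0 < G t x"
  unfolding G_def using N2 y_pos[OF assms] g_pos by (intro sum_pos mult_pos_pos) auto

lemma speed_pos:
  assumes "t \<in> I" "x \<in> closure \<Omega>" "j \<in> {1..N-1}"
  shows "0 < z j t x + G t x"
  using interlaced_roots.z_pos[OF interlaced] G_pos assms by (intro add_pos_pos) blast+

lemma z_derivative:
  assumes t: "t \<in> I" and x: "x \<in> closure \<Omega>" and j: "j \<in> {1..N-1}"
  shows "(z j t has_derivative (\<lambda>h. - (\<Sum>i=1..N. frechet_derivative (\<lambda>x. y t x i) (at x within closure \<Omega>) h
      / (g i - z j t x)) / slope j t x)) (at x within closure \<Omega>)"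
proof -
  have "((\<lambda>x. y t x i) has_derivative frechet_derivative (\<lambda>x. y t x i) (at x within closure \<Omega>))
      (at x within closure \<Omega>)" if "i \<in> {1..N}" for i
    using y_differentiable[OF t that] x by (simp add: differentiable_on_def frechet_derivative_works)
  from has_derivative_root_var[OF j x y_pos[OF t] this]
  show ?thesis by (simp add: z_def [abs_def] slope_def)
qed

lemma grad_z:
  assumes t: "t \<in> I" and x: "x \<in> closure \<Omega>" and j: "j \<in> {1..N-1}"
  shows "grad (closure \<Omega>) (z j t) x $ k = - (\<Sum>i=1..N. dy t k i x / (g i - z j t x)) / slope j t x"
  using partial_deriv_closure_eq[OF domain x z_derivative[OF t x j]]
  by (simp add: grad_def dy_def partial_deriv_def)

lemma grad_z_flux:
  assumes t: "t \<in> I" and x: "x \<in> closure \<Omega>" and j: "j \<in> {1..N-1}"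
  shows "grad (closure \<Omega>) (z j t) x $ k = (z j t x + G t x) * (flux_moment j t k x / slope j t x)"
  using interlaced_roots.root_derivative_flux[OF interlaced[OF t x] J_sum[OF t x] y_sum[OF t x]
      flux_mean_def dy_flux[OF t x] G_pos[OF t x] j]
  by (simp add: grad_z[OF assms] flux_moment_def)

lemma neumann:
  assumes t: "t \<in> I" and x: "x \<in> frontier \<Omega>" and j: "j \<in> {1..N-1}"
  shows "grad (closure \<Omega>) (z j t) x \<bullet> \<nu> x = 0"
proof -
  have no_flux: "J t x i \<bullet> \<nu> x = 0" if "i \<in> {1..N}" for i
    using solution t x that unfolding classical_MS_solution_def by blast
  have "grad (closure \<Omega>) (z j t) x \<bullet> \<nu> x
      = (\<Sum>k\<in>UNIV. (z j t x + G t x) / slope j t x * (\<Sum>i=1..N. J t x i $ k * \<nu> x $ k / (g i - z j t x)))"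
    unfolding inner_vec_def
    by (intro sum.cong refl)
      (simp add: grad_z_flux[OF t frontier_closure[OF x] j] flux_moment_def sum_distrib_left sum_distrib_right sum_divide_distrib mult_ac)
  also have "\<dots> = (z j t x + G t x) / slope j t x * (\<Sum>i=1..N. J t x i \<bullet> \<nu> x / (g i - z j t x))"
    unfolding sum_distrib_left [symmetric]
    by (subst sum.swap) (simp add: inner_vec_def sum_divide_distrib)
  also have "\<dots> = 0" using no_flux by simp
  finally show ?thesis .
qed

text \<open>Dividing \<open>dy_flux\<close> by \<open>g i + G\<close> and summing removes the
  fluxes, because their total is zero, and gives \<open>flux_mean\<close> as the quotient
  \<open>m\<close> of differentiable functions. Each flux then follows by solving the relation for
  \<open>J\<close>.\<close>

lemma J_differentiable:
  assumes t: "t \<in> I" and x: "x \<in> \<Omega>" and i: "i \<in> {1..N}"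
  shows "(\<lambda>x. J t x i $ k) differentiable (at x)"
proof -
  define m where "m x = (\<Sum>l=1..N. dy t k l x / (g l + G t x)) / (\<Sum>l=1..N. y t x l / (g l + G t x))" for x
  have pos: "0 < g l + G t x" if "x \<in> \<Omega>" "l \<in> {1..N}" for x l
    using g_pos[OF that(2)] G_pos[OF t domain_closure[OF that(1)]] by simp
  have weight_pos: "0 < (\<Sum>l=1..N. y t x l / (g l + G t x))" if "x \<in> \<Omega>" for x
    using N2 y_pos[OF t domain_closure[OF that]] pos[OF that] by (intro sum_pos divide_pos_pos) auto
  have flux_mean: "flux_mean t k x = m x" if x: "x \<in> \<Omega>" for x
  proof -
    have "dy t k l x / (g l + G t x) = flux_mean t k x * (y t x l / (g l + G t x)) - J t x l $ k"
      if "l \<in> {1..N}" for l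
      using pos[OF x that] by (simp add: dy_flux[OF t domain_closure[OF x] that] field_simps)
    then have "(\<Sum>l=1..N. dy t k l x / (g l + G t x))
        = flux_mean t k x * (\<Sum>l=1..N. y t x l / (g l + G t x))"
      using J_sum[OF t domain_closure[OF x], of k] by (simp add: sum_subtractf sum_distrib_left)
    then show ?thesis using weight_pos[OF x] by (simp add: m_def)
  qed
  have J_eq: "(y t x i * m x - dy t k i x) / (g i + G t x) = J t x i $ k" if "x \<in> \<Omega>" for x
    using pos[OF that i] dy_flux[OF t domain_closure[OF that] i, of k] flux_mean[OF that]
    by (simp add: field_simps)
  note y_diff = y_differentiable_at[OF t x]
  have dy_diff: "dy t k l differentiable (at x)" if "l \<in> {1..N}" for l
    using dy_differentiable[OF t that] x open_domain
    by (metis at_within_open differentiable_on_def)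
  have G_diff: "G t differentiable (at x)"
    unfolding G_def [abs_def]
    by (intro differentiable_sum ballI differentiable_mult differentiable_const y_diff finite_atLeastAtMost)
  have ne: "g l + G t x \<noteq> 0" if "l \<in> {1..N}" for l
    using pos[OF x that] by simp
  have m_diff: "m differentiable (at x)"
    unfolding m_def [abs_def]
    by (intro differentiable_divide differentiable_sum ballI differentiable_add differentiable_const
        y_diff dy_diff G_diff finite_atLeastAtMost ne) (use weight_pos[OF x] in auto)
  have "(\<lambda>x. (y t x i * m x - dy t k i x) / (g i + G t x)) differentiable (at x)"
    by (intro differentiable_divide differentiable_diff differentiable_mult differentiable_add
        differentiable_const y_diff dy_diff G_diff m_diff ne i)
  then obtain D where "((\<lambda>x. (y t x i * m x - dy t k i x) / (g i + G t x)) has_derivative D) (at x)"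
    by (auto simp: differentiable_def)
  then have "((\<lambda>x. J t x i $ k) has_derivative D) (at x)"
    using J_eq by (rule has_derivative_transform_within_open[OF _ open_domain x])
  then show ?thesis by (auto simp: differentiable_def)
qed

lemma z_time_derivative:
  assumes t: "t \<in> I" and x: "x \<in> \<Omega>" and j: "j \<in> {1..N-1}"
  shows "((\<lambda>s. z j s x) has_real_derivative
    (\<Sum>i=1..N. divergence (closure \<Omega>) (\<lambda>x'. J t x' i) x / (g i - z j t x)) / slope j t x) (at t)"
proof -
  have "((\<lambda>s. y s x i) has_derivative (\<lambda>h. deriv (\<lambda>s. y s x i) t * h)) (at t within I)"
    if "i \<in> {1..N}" for i
  proof -
    have "((\<lambda>s. y s x i) has_real_derivative deriv (\<lambda>s. y s x i) t) (at t)"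
      using y_time_differentiable[OF t that x] by (simp add: DERIV_deriv_iff_real_differentiable)
    then show ?thesis
      unfolding has_field_derivative_def by (rule has_derivative_at_withinI)
  qed
  \<comment> \<open>Positivity of \<open>y\<close> is available for times in \<open>I\<close>, so
    the derivative is first taken within \<open>I\<close>, which is open.\<close>
  from has_derivative_root_var[OF j t y_pos[OF _ domain_closure[OF x]] this]
  have "((\<lambda>s. z j s x) has_derivative (\<lambda>h. - (\<Sum>i=1..N. deriv (\<lambda>s. y s x i) t * h / (g i - z j t x))
      / slope j t x)) (at t within I)"
    by (simp add: z_def slope_def)
  moreover have "(\<Sum>i=1..N. deriv (\<lambda>s. y s x i) t * h / (g i - z j t x))
      = - (h * (\<Sum>i=1..N. divergence (closure \<Omega>) (\<lambda>x'. J t x' i) x / (g i - z j t x)))" for h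
    unfolding sum_distrib_left sum_negf [symmetric]
    by (intro sum.cong refl) (simp add: conservation[OF t x])
  ultimately show ?thesis
    unfolding at_within_open[OF t open_I]
    by (intro has_derivative_imp_has_field_derivative) auto
qed

text \<open>In \<Omega> the field \<open>F\<close> equals \<open>flux_moment\<close> over
  \<open>slope\<close>, so its divergence involves only first derivatives of \<open>J\<close>,
  \<open>y\<close> and \<open>z\<close>. The divergences of the fluxes cancel against the time
  derivative, and \<open>root_balance\<close> evaluates the rest in each direction.\<close>

lemma root_equation:
  assumes t: "t \<in> I" and x: "x \<in> \<Omega>" and j: "j \<in> {1..N-1}"
  defines "\<Lambda> \<equiv> \<lambda>j x. z j t x + G t x"
  defines "F \<equiv> \<lambda>x. grad (closure \<Omega>) (z j t) x /\<^sub>R \<Lambda> j x"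
  shows "F differentiable (at x)"
    and "deriv (\<lambda>s. z j s x) t - divergence (closure \<Omega>) F x
      + (\<Sum>k\<in>{1..N-1} - {j}. (\<Lambda> j x + \<Lambda> k x) / (\<Lambda> j x * \<Lambda> k x * (\<Lambda> j x - \<Lambda> k x))
           * (grad (closure \<Omega>) (z j t) x \<bullet> grad (closure \<Omega>) (z k t) x)) = 0"
proof -
  note xc = domain_closure[OF x]
  interpret r: interlaced_roots N g "y t x" "\<lambda>k. z k t x" by (rule interlaced[OF t xc])
  have slope: "slope l t x = r.slope l" for l by (rule slope_eq[OF t xc])
  define S where "S = slope j t x"
  define Y' where "Y' i = frechet_derivative (\<lambda>x. y t x i) (at x)" for i
  define J' where "J' k i = frechet_derivative (\<lambda>x. J t x i $ k) (at x)" for k i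
  define z' where "z' h = - (\<Sum>i=1..N. Y' i h / (g i - z j t x)) / S" for h
  define P where "P k = (\<Sum>i=1..N. J t x i $ k / (g i - z j t x))" for k
  define Q where "Q k = (\<Sum>i=1..N. J t x i $ k / (g i - z j t x)\<^sup>2)" for k
  define T where "T = (\<Sum>i=1..N. y t x i / (g i - z j t x) ^ 3)"
  define F' where "F' k h = ((\<Sum>i=1..N. J' k i h / (g i - z j t x)) + Q k * z' h) / S
      - P k * ((\<Sum>i=1..N. Y' i h / (g i - z j t x)\<^sup>2) + 2 * T * z' h) / S\<^sup>2" for k h
  have S_pos: "0 < S" using r.slope_pos[OF j] by (simp add: S_def slope)
  have Y': "((\<lambda>x. y t x i) has_derivative Y' i) (at x)" if "i \<in> {1..N}" for i
    using y_differentiable_at[OF t x that] by (simp add: frechet_derivative_works Y'_def)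
  have J': "((\<lambda>x. J t x i $ k) has_derivative J' k i) (at x)" if "i \<in> {1..N}" for i k
    using J_differentiable[OF t x that] by (simp add: frechet_derivative_works J'_def)
  have z': "(z j t has_derivative z') (at x)"
    using z_derivative[OF t xc j] by (simp add: at_within_domain[OF x] z'_def [abs_def] Y'_def S_def)
  have dy: "Y' i (axis k 1) = dy t k i x" for i k
    by (simp add: Y'_def dy_def partial_deriv_def at_within_domain[OF x])

  have F_eq: "flux_moment j t k q / slope j t q = F q $ k" if "q \<in> \<Omega>" for q k
    using speed_pos[OF t domain_closure[OF that] j]
    by (simp add: F_def \<Lambda>_def grad_z_flux[OF t domain_closure[OF that] j])
  have F': "((\<lambda>q. F q $ k) has_derivative F' k) (at x)" for k
  proof -
    have "((\<lambda>q. flux_moment j t k q / slope j t q) has_derivative F' k) (at x)"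
      unfolding flux_moment_def slope_def F'_def [abs_def] P_def Q_def T_def S_def
      using S_pos r.nz[OF j]
      by (intro has_derivative_sum_quotient J' Y' z') (auto simp: S_def slope_def)
    then show ?thesis
      using F_eq by (rule has_derivative_transform_within_open[OF _ open_domain x])
  qed
  show "F differentiable (at x)"
    unfolding differentiable_componentwise_within[of F x UNIV]
    using F' by (auto simp: Basis_vec_def inner_axis differentiable_def)
  have div_F: "divergence (closure \<Omega>) F x = (\<Sum>k\<in>UNIV. F' k (axis k 1))"
    unfolding divergence_def
    by (intro sum.cong refl partial_deriv_closure_eq[OF domain xc]) (simp add: at_within_domain[OF x] F')
  have div_J: "divergence (closure \<Omega>) (\<lambda>x'. J t x' i) x = (\<Sum>k\<in>UNIV. J' k i (axis k 1))"
    if "i \<in> {1..N}" for i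
    unfolding divergence_def
    by (intro sum.cong refl partial_deriv_closure_eq[OF domain xc]) (simp add: at_within_domain[OF x] J'[OF that])
  have "deriv (\<lambda>s. z j s x) t
      = (\<Sum>i=1..N. divergence (closure \<Omega>) (\<lambda>x'. J t x' i) x / (g i - z j t x)) / S"
    unfolding S_def by (rule DERIV_imp_deriv[OF z_time_derivative[OF t x j]])
  also have "\<dots> = (\<Sum>i=1..N. \<Sum>k\<in>UNIV. J' k i (axis k 1) / (g i - z j t x) / S)"
    by (simp add: div_J sum_divide_distrib)
  also have "\<dots> = (\<Sum>k\<in>UNIV. (\<Sum>i=1..N. J' k i (axis k 1) / (g i - z j t x)) / S)"
    by (subst sum.swap) (simp add: sum_divide_distrib)
  finally have time: "deriv (\<lambda>s. z j s x) t = \<dots>" .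

  have grad_eq: "grad (closure \<Omega>) (z l t) x $ k = - (\<Sum>i=1..N. dy t k i x / (g i - z l t x)) / r.slope l"
    if "l \<in> {1..N-1}" for l k
    using grad_z[OF t xc that] by (simp add: slope)
  have balance: "(\<Sum>i=1..N. J' k i (axis k 1) / (g i - z j t x)) / S - F' k (axis k 1)
      = - (\<Sum>l\<in>{1..N-1} - {j}. (\<Lambda> j x + \<Lambda> l x) / (\<Lambda> j x * \<Lambda> l x * (\<Lambda> j x - \<Lambda> l x))
           * (grad (closure \<Omega>) (z j t) x $ k * grad (closure \<Omega>) (z l t) x $ k))" for k
  proof -
    have z'_axis: "z' (axis k 1) = grad (closure \<Omega>) (z j t) x $ k"
      using grad_z[OF t xc j] by (simp add: z'_def dy S_def)
    have sum_eq: "(\<Sum>l\<in>{1..N-1} - {j}. (\<Lambda> j x + \<Lambda> l x) / (\<Lambda> j x * \<Lambda> l x * (\<Lambda> j x - \<Lambda> l x))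
          * (grad (closure \<Omega>) (z j t) x $ k * grad (closure \<Omega>) (z l t) x $ k))
      = (\<Sum>l\<in>{1..N-1} - {j}. (\<Lambda> j x + \<Lambda> l x) / (\<Lambda> j x * \<Lambda> l x * (\<Lambda> j x - \<Lambda> l x))
          * (- (\<Sum>i=1..N. dy t k i x / (g i - z j t x)) / r.slope j
             * (- (\<Sum>i=1..N. dy t k i x / (g i - z l t x)) / r.slope l)))"
      by (rule sum.cong[OF refl]) (simp only: grad_eq[OF j] grad_eq Diff_iff)
    have "Q k * grad (closure \<Omega>) (z j t) x $ k / S
        - P k * ((\<Sum>i=1..N. dy t k i x / (g i - z j t x)\<^sup>2) + 2 * T * grad (closure \<Omega>) (z j t) x $ k) / S\<^sup>2
      = (\<Sum>l\<in>{1..N-1} - {j}. (\<Lambda> j x + \<Lambda> l x) / (\<Lambda> j x * \<Lambda> l x * (\<Lambda> j x - \<Lambda> l x))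
           * (grad (closure \<Omega>) (z j t) x $ k * grad (closure \<Omega>) (z l t) x $ k))"
      unfolding sum_eq unfolding grad_eq[OF j] P_def Q_def T_def S_def slope \<Lambda>_def
      by (rule r.root_balance[OF J_sum[OF t xc] y_sum[OF t xc] flux_mean_def dy_flux[OF t xc] G_pos[OF t xc] j])
    then show ?thesis
      by (simp add: F'_def z'_axis dy add_divide_distrib)
  qed
  have "deriv (\<lambda>s. z j s x) t - divergence (closure \<Omega>) F x
      = (\<Sum>k\<in>UNIV. (\<Sum>i=1..N. J' k i (axis k 1) / (g i - z j t x)) / S - F' k (axis k 1))"
    by (simp add: time div_F sum_subtractf)
  also have "\<dots> = - (\<Sum>l\<in>{1..N-1} - {j}. (\<Lambda> j x + \<Lambda> l x) / (\<Lambda> j x * \<Lambda> l x * (\<Lambda> j x - \<Lambda> l x))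
      * (grad (closure \<Omega>) (z j t) x \<bullet> grad (closure \<Omega>) (z l t) x))"
    unfolding balance sum_negf
    by (subst sum.swap) (simp add: inner_vec_def sum_distrib_left)
  finally show "deriv (\<lambda>s. z j s x) t - divergence (closure \<Omega>) F x
      + (\<Sum>k\<in>{1..N-1} - {j}. (\<Lambda> j x + \<Lambda> k x) / (\<Lambda> j x * \<Lambda> k x * (\<Lambda> j x - \<Lambda> k x))
           * (grad (closure \<Omega>) (z j t) x \<bullet> grad (closure \<Omega>) (z k t) x)) = 0"
    by simp
qed

end

text \<open>\<open>deriv\<close> and \<open>divergence\<close> are total, so the pointwise identity
  alone would not assert that the derivatives in it exist; the differentiability statements
  accompany it for this reason.\<close>

theorem theorem5p1:
  fixes N :: nat
    and g :: "nat \<Rightarrow> real" and f :: "nat \<Rightarrow> nat \<Rightarrow> real"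
    and I :: "real set" and \<Omega> :: "(real^'d) set" and \<nu> :: "real^'d \<Rightarrow> real^'d"
    and y :: "real \<Rightarrow> real^'d \<Rightarrow> nat \<Rightarrow> real"
    and J :: "real \<Rightarrow> real^'d \<Rightarrow> nat \<Rightarrow> real^'d"
    and z \<Lambda> :: "nat \<Rightarrow> real \<Rightarrow> real^'d \<Rightarrow> real"
  assumes "N \<ge> 2"
    and "0 < g 1" and "strict_mono_on {1..N} g"
    and "\<And>i j. i \<in> {1..N} \<Longrightarrow> j \<in> {1..N} \<Longrightarrow> i \<noteq> j \<Longrightarrow> f i j = g i + g j"
    and "CARD('d) \<ge> 2" and "bounded_C2_domain \<Omega>"
    and "\<And>x. x \<in> frontier \<Omega> \<Longrightarrow> outer_unit_normal \<Omega> x (\<nu> x)"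
    and "open I" and "is_interval I"
    and "\<And>t x. t \<in> I \<Longrightarrow> x \<in> closure \<Omega> \<Longrightarrow> y t x \<in> open_simplex N"
    and "classical_MS_solution N f I \<Omega> \<nu> y J"
    and z_def: "z = (\<lambda>j t x. root_var N g j (y t x))"
    and \<Lambda>_def: "\<Lambda> = (\<lambda>j t x. z j t x + (\<Sum>i=1..N. g i * y t x i))"
  shows "\<forall>j\<in>{1..N-1}. \<forall>t\<in>I.
     z j t differentiable_on closure \<Omega> \<and>
     (\<forall>x\<in>\<Omega>.
        (\<lambda>s. z j s x) differentiable (at t) \<and>
        (\<lambda>x'. grad (closure \<Omega>) (z j t) x' /\<^sub>R \<Lambda> j t x') differentiable (at x) \<and>
        deriv (\<lambda>s. z j s x) t
          - divergence (closure \<Omega>) (\<lambda>x'. grad (closure \<Omega>) (z j t) x' /\<^sub>R \<Lambda> j t x') x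
          + (\<Sum>k\<in>{1..N-1} - {j}.
               (\<Lambda> j t x + \<Lambda> k t x) / (\<Lambda> j t x * \<Lambda> k t x * (\<Lambda> j t x - \<Lambda> k t x))
               * (grad (closure \<Omega>) (z j t) x \<bullet> grad (closure \<Omega>) (z k t) x)) = 0) \<and>
     (\<forall>x\<in>frontier \<Omega>. grad (closure \<Omega>) (z j t) x \<bullet> \<nu> x = 0)"
proof -
  interpret flow: MS_flow N g f I \<Omega> \<nu> y J
    using assms(1-4,6,8,10,11) by unfold_locales
  have z: "z = flow.z" and \<Lambda>: "\<Lambda> = (\<lambda>j t x. flow.z j t x + flow.G t x)"
    by (auto simp: z_def \<Lambda>_def flow.z_def flow.G_def fun_eq_iff)
  have "flow.z j t differentiable_on closure \<Omega>" if "t \<in> I" "j \<in> {1..N-1}" for j t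
    using flow.z_derivative[OF that(1) _ that(2)]
    unfolding differentiable_on_def differentiable_def by blast
  moreover have "(\<lambda>s. flow.z j s x) differentiable (at t)"
    if "t \<in> I" "x \<in> \<Omega>" "j \<in> {1..N-1}" for j t x
    using flow.z_time_derivative[OF that] unfolding has_field_derivative_def by (rule differentiableI)
  ultimately show ?thesis
    unfolding z \<Lambda> using flow.root_equation flow.neumann by blast
qed

end
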